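(* Let $(X,d,\mu)$, $p$, $\underline{Q}_\mu$ be as in the context. Fix $\underline{\theta}\in[0,\min\{p,\underline{Q}_\mu\})$, $\theta\in[\underline{\theta},p)$, an integer $N\ge2$, numbers $0<\theta_1<\dots<\theta_N=\underline{\theta}$, closed sets $S^i\in\mathcal{ADR}_{\theta_i}(X)$, $S:=\bigcup_{i=1}^NS^i$, and $\mathfrak m_k:=\sum_{i=1}^N2^{k(\theta-\theta_i)}\mathcal H_{\theta_i}\lfloor_{S^i}$, $k\in\mathbb N_0$. For each $i$ let $\sigma_i\in(0,1)$ be such that $S^i$ is $\sigma_i$-porous, and put $\sigma(S):=\prod_{i=1}^N\frac{2\sigma_i}{3}$. Then for each $\sigma\in(0,\sigma(S)]$ there is a constant $C>0$ such that $$\operatorname{BN}_{p,\{\mathfrak m_k\},\sigma}(f)\le C\Big(\sum_{i=1}^N\|f|\mathrm B^{1-\theta_i/p}_p(S^i)\|+\mathcal{GL}^{(1)}_p(f)\Big)\quad\text{for all } f\in\bigcap_{i=1}^NL_p(\mathcal H_{\theta_i}\lfloor_{S^i}).$$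
   Context: Standing setting: $(X,d)$ complete separable metric space, $\mu$ a Borel regular locally finite outer measure, $\operatorname{supp}\mu=X$, uniformly locally doubling (for every $R>0$, $\sup_{r\in(0,R]}\sup_x\mu(B_{2r}(x))/\mu(B_r(x))<\infty$). Balls are closed, $B_r(x)=\{y:d(x,y)\le r\}$, $cB_r(x)=B_{cr}(x)$, $B_k(x)=B_{2^{-k}}(x)$. A fixed $p\in(1,\infty)$; $X$ supports a weak local $(1,p)$-Poincaré inequality (for every $R>0$ there are $C,\lambda\ge1$ with $\inf_c\frac{1}{\mu(B_r(x))}\int_{B_r(x)}|f-c|d\mu\le Cr(\frac{1}{\mu(B_{\lambda r}(x))}\int_{B_{\lambda r}(x)}(\operatorname{lip}f)^pd\mu)^{1/p}$ for Lipschitz $f$, $x\in X$, $r\in(0,R]$, with $\operatorname{lip}f(y)=\limsup_{z\to y}|f(y)-f(z)|/d(y,z)$). $\underline{Q}_\mu$ is the infimum of $Q>0$ such that for every $R>0$ there is $C$ with $(r_{B'}/r_B)^Q\le C\mu(B')/\mu(B)$ for balls $B'\subset B$, $0<r_{B'}\le r_B\le R$. Notation: $\mathrm{Av}_{G,\mathfrak m}(g)=\mathfrak m(G)^{-1}\int_Gg\,d\mathfrak m$ if $\mathfrak m(G)>0$, else $0$; $\mathcal E_{\mathfrak m}(g,G):=\inf_{c\in\mathbb R}\mathrm{Av}_{G,\mathfrak m}(|g-c|)$; $\mathfrak m\lfloor_S(E)=\mathfrak m(E\cap S)$. $\mathcal H_{\vartheta,\delta}(E):=\inf\{\sum\mu(B_{r_i}(x_i))r_i^{-\vartheta}:E\subset\bigcup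 B_{r_i}(x_i),0<r_i<\delta\}$, $\mathcal H_\vartheta=\lim_{\delta\to0}\mathcal H_{\vartheta,\delta}$. $\mathcal{ADR}_\vartheta(X)$: closed $S'$ with $\varkappa_1\mu(B_r(x))r^{-\vartheta}\le\mathcal H_\vartheta(B_r(x)\cap S')\le\varkappa_2\mu(B_r(x))r^{-\vartheta}$ for $x\in S'$, $r\in(0,1]$. Porosity: a ball $B$ is $(S',\sigma)$-porous if there is a ball $B'\subset B\setminus S'$ with $r(B')\ge\sigma r(B)$; $S'_r(\sigma):=\{x\in S':B_r(x)\text{ is }(S',\sigma)\text{-porous}\}$; $S'$ is $\sigma$-porous if $S'_r(\sigma)=S'$ for all $r\in(0,1]$. Besov norm: for $S'\in\mathcal{ADR}_\vartheta(X)$, $s>0$: $\|f|\mathrm B^s_p(S')\|:=\|f|L_p(\mathcal H_\vartheta\lfloor_{S'})\|+(\sum_{k\ge1}2^{ksp}\int_{S'}(\mathcal E_{\mathcal H_\vartheta\lfloor_{S'}}(f,B_k(x)))^pd\mathcal H_\vartheta(x))^{1/p}$. Functional $\operatorname{BN}$: for $r>0$ let $k(r)$ be the integer with $r\in(2^{-k(r)-1},2^{-k(r)}]$; $\widetilde{\mathcal E}_{\mathfrak m_k}(f,B_r(x)):=\mathcal E_{\mathfrak m_k}(f,B_{2r}(x))$ if $B_r(x)\cap S\ne\emptyset$ and $0$ otherwise; $f^\sharp(x):=\sup_{r\in(0,1]}\frac1r\widetilde{\mathcal E}_{\mathfrak m_{k(r)}}(f,B_r(x))$, $x\in X$. Then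 $\operatorname{BN}_{p,\{\mathfrak m_k\},\sigma}(f):=\|f|L_p(\mathfrak m_0)\|+\|f^\sharp|L_p(S,\mu)\|+\big(\sum_{k\ge1}2^{k(\theta-p)}\int_{S_{2^{-k}}(\sigma)}(\mathcal E_{\mathfrak m_k}(f,B_k(x)))^pd\mathfrak m_k(x)\big)^{1/p}$. Gluing functional: $\Sigma^{i,j}_k:=\{(y,z)\in S^i\times S^j:d(y,z)\le2^{-k}\}$, $\operatorname{w}_k(y,z):=(\mu(B_k(y))\mu(B_k(z)))^{-1/2}$, $\mathcal{GL}^{(1)}_p(f):=\big(\sum_{i\ne j}\sum_{k\ge1}2^{k(p-\theta_i-\theta_j)}\iint_{\Sigma^{i,j}_k}\operatorname{w}_k(y,z)|f(y)-f(z)|^pd\mathcal H_{\theta_i}(y)d\mathcal H_{\theta_j}(z)\big)^{1/p}$. *)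

theory Defs
  imports "HOL-Analysis.Analysis"
begin

definition epow :: "ennreal \<Rightarrow> real \<Rightarrow> ennreal" where
  "epow x q = (if x = \<infinity> then \<infinity> else ennreal (enn2real x powr q))"

text \<open>The outer measure mu is represented by its restriction to Borel sets
  (a Borel measure M with sets M = sets borel); only values on closed balls
  are ever used. Balls are closed: cball x r.\<close>

definition lip :: "('a::metric_space \<Rightarrow> real) \<Rightarrow> 'a \<Rightarrow> ennreal" where
  "lip f y = e2ennreal (Limsup (at y) (\<lambda>z. ereal (\<bar>f y - f z\<bar> / dist y z)))"

definition Av :: "'a measure \<Rightarrow> 'a set \<Rightarrow> ('a \<Rightarrow> ennreal) \<Rightarrow> ennreal" where
  "Av m G g = (if emeasure m G > 0 then (\<integral>\<^sup>+x. g x * indicator G x \<partial>m) / emeasure m G else 0)"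

definition Eosc :: "'a measure \<Rightarrow> ('a \<Rightarrow> real) \<Rightarrow> 'a set \<Rightarrow> ennreal" where
  "Eosc m g G = (INF c::real. Av m G (\<lambda>y. ennreal \<bar>g y - c\<bar>))"

definition standing_space :: "'a::{complete_space, second_countable_topology} measure \<Rightarrow> real \<Rightarrow> bool" where
  "standing_space M p \<longleftrightarrow>
     sets M = sets borel \<and>
     (\<forall>x. \<exists>r>0. emeasure M (cball x r) < \<infinity>) \<and>
     (\<forall>x r. r > 0 \<longrightarrow> emeasure M (cball x r) > 0) \<and>
     (\<forall>R>0. \<exists>C::real. \<forall>r\<in>{0<..R}. \<forall>x. emeasure M (cball x (2*r)) \<le> ennreal C * emeasure M (cball x r)) \<and>
     1 < p \<and>
     (\<forall>R>0. \<exists>C \<ge> 1. \<exists>lam\<ge>(1::real). \<forall>f::'a \<Rightarrow> real. (\<exists>L. L-lipschitz_on UNIV f) \<longrightarrow>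
        (\<forall>x. \<forall>r\<in>{0<..R}.
          (INF c::real. Av M (cball x r) (\<lambda>y. ennreal \<bar>f y - c\<bar>))
            \<le> ennreal (C * r) * epow (Av M (cball x (lam*r)) (\<lambda>y. epow (lip f y) p)) (1/p)))"

definition Qlow :: "'a::metric_space measure \<Rightarrow> real" where
  "Qlow M = Inf {Q::real. Q > 0 \<and> (\<forall>R>0. \<exists>C::real. \<forall>x x' r r'.
       cball x' r' \<subseteq> cball x r \<longrightarrow> 0 < r' \<longrightarrow> r' \<le> r \<longrightarrow> r \<le> R \<longrightarrow>
         ennreal ((r'/r) powr Q) * emeasure M (cball x r) \<le> ennreal C * emeasure M (cball x' r'))}"

definition Hdelta :: "'a::metric_space measure \<Rightarrow> real \<Rightarrow> real \<Rightarrow> 'a set \<Rightarrow> ennreal" where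
  "Hdelta M vt \<delta> E = (INF F \<in> {F::('a \<times> real) set. countable F \<and> (\<forall>(x,r)\<in>F. 0 < r \<and> r < \<delta>)
        \<and> E \<subseteq> (\<Union>(x,r)\<in>F. cball x r)}.
      \<integral>\<^sup>+b. emeasure M (cball (fst b) (snd b)) * ennreal (snd b powr (-vt)) \<partial>count_space F)"

definition Hcal :: "'a::metric_space measure \<Rightarrow> real \<Rightarrow> 'a set \<Rightarrow> ennreal" where
  "Hcal M vt E = (SUP \<delta>\<in>{0<..}. Hdelta M vt \<delta> E)"

definition Hrestr :: "'a::metric_space measure \<Rightarrow> real \<Rightarrow> 'a set \<Rightarrow> 'a measure" where
  "Hrestr M vt S = measure_of UNIV (sets borel) (\<lambda>E. Hcal M vt (E \<inter> S))"

definition ADR :: "'a::metric_space measure \<Rightarrow> real \<Rightarrow> 'a set \<Rightarrow> bool" where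
  "ADR M vt S' \<longleftrightarrow> closed S' \<and> (\<exists>k1 k2::real. 0 < k1 \<and> 0 < k2 \<and>
     (\<forall>x\<in>S'. \<forall>r\<in>{0<..1}.
        ennreal k1 * emeasure M (cball x r) * ennreal (r powr (-vt)) \<le> Hcal M vt (cball x r \<inter> S') \<and>
        Hcal M vt (cball x r \<inter> S') \<le> ennreal k2 * emeasure M (cball x r) * ennreal (r powr (-vt))))"

definition porous_ball :: "'a::metric_space set \<Rightarrow> real \<Rightarrow> 'a \<Rightarrow> real \<Rightarrow> bool" where
  "porous_ball S' \<sigma> x r \<longleftrightarrow> (\<exists>y r'. r' \<ge> \<sigma> * r \<and> cball y r' \<subseteq> cball x r - S')"

definition porous_part :: "'a::metric_space set \<Rightarrow> real \<Rightarrow> real \<Rightarrow> 'a set" where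
  "porous_part S' r \<sigma> = {x\<in>S'. porous_ball S' \<sigma> x r}"

definition porous :: "'a::metric_space set \<Rightarrow> real \<Rightarrow> bool" where
  "porous S' \<sigma> \<longleftrightarrow> (\<forall>r\<in>{0<..1}. porous_part S' r \<sigma> = S')"

definition Lpnorm :: "'a measure \<Rightarrow> real \<Rightarrow> ('a \<Rightarrow> real) \<Rightarrow> ennreal" where
  "Lpnorm m p f = epow (\<integral>\<^sup>+x. epow (ennreal \<bar>f x\<bar>) p \<partial>m) (1/p)"

definition Besov :: "'a::metric_space measure \<Rightarrow> real \<Rightarrow> real \<Rightarrow> real \<Rightarrow> 'a set \<Rightarrow> ('a \<Rightarrow> real) \<Rightarrow> ennreal" where
  "Besov M vt s p S' f =
     Lpnorm (Hrestr M vt S') p f +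
     epow (\<Sum>k. ennreal (2 powr (real (Suc k) * s * p)) *
        (\<integral>\<^sup>+x. epow (Eosc (Hrestr M vt S') f (cball x ((1/2)^(Suc k)))) p \<partial>Hrestr M vt S')) (1/p)"

text \<open>k(r): the integer k with r in (2^(-k-1), 2^(-k)]; only used for r in (0,1].\<close>
definition kr :: "real \<Rightarrow> nat" where
  "kr r = (THE k::nat. (1/2)^(k+1) < r \<and> r \<le> (1/2)^k)"

definition Etilde :: "(nat \<Rightarrow> 'a measure) \<Rightarrow> 'a::metric_space set \<Rightarrow> ('a \<Rightarrow> real) \<Rightarrow> 'a \<Rightarrow> real \<Rightarrow> ennreal" where
  "Etilde m S f x r = (if cball x r \<inter> S \<noteq> {} then Eosc (m (kr r)) f (cball x (2*r)) else 0)"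

definition sharp :: "(nat \<Rightarrow> 'a measure) \<Rightarrow> 'a::metric_space set \<Rightarrow> ('a \<Rightarrow> real) \<Rightarrow> 'a \<Rightarrow> ennreal" where
  "sharp m S f x = (SUP r\<in>{0<..1}. ennreal (1/r) * Etilde m S f x r)"

definition BN :: "'a::metric_space measure \<Rightarrow> real \<Rightarrow> real \<Rightarrow> (nat \<Rightarrow> 'a measure) \<Rightarrow> 'a set \<Rightarrow> real \<Rightarrow> ('a \<Rightarrow> real) \<Rightarrow> ennreal" where
  "BN M p \<theta> m S \<sigma> f =
     Lpnorm (m 0) p f +
     epow (\<integral>\<^sup>+x. epow (sharp m S f x) p * indicator S x \<partial>M) (1/p) +
     epow (\<Sum>k. ennreal (2 powr (real (Suc k) * (\<theta> - p))) *
        (\<integral>\<^sup>+x. epow (Eosc (m (Suc k)) f (cball x ((1/2)^(Suc k)))) p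
              * indicator (porous_part S ((1/2)^(Suc k)) \<sigma>) x \<partial>m (Suc k))) (1/p)"

definition weight :: "'a::metric_space measure \<Rightarrow> nat \<Rightarrow> 'a \<Rightarrow> 'a \<Rightarrow> ennreal" where
  "weight M k y z = inverse (epow (emeasure M (cball y ((1/2)^k)) * emeasure M (cball z ((1/2)^k))) (1/2))"

definition GL :: "'a::metric_space measure \<Rightarrow> real \<Rightarrow> nat \<Rightarrow> (nat \<Rightarrow> real) \<Rightarrow> (nat \<Rightarrow> 'a set) \<Rightarrow> ('a \<Rightarrow> real) \<Rightarrow> ennreal" where
  "GL M p N th S f = epow
     (\<Sum>(i,j)\<in>{(i,j). i \<in> {1..N} \<and> j \<in> {1..N} \<and> i \<noteq> j}.
       \<Sum>k. ennreal (2 powr (real (Suc k) * (p - th i - th j))) *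
         (\<integral>\<^sup>+z. \<integral>\<^sup>+y. indicator {(y,z). dist y z \<le> (1/2)^(Suc k)} (y,z) *
              weight M (Suc k) y z * epow (ennreal \<bar>f y - f z\<bar>) p \<partial>Hrestr M (th i) (S i) \<partial>Hrestr M (th j) (S j)))
     (1/p)"

definition mk :: "'a::metric_space measure \<Rightarrow> real \<Rightarrow> nat \<Rightarrow> (nat \<Rightarrow> real) \<Rightarrow> (nat \<Rightarrow> 'a set) \<Rightarrow> nat \<Rightarrow> 'a measure" where
  "mk M \<theta> N th S k = measure_of UNIV (sets borel)
     (\<lambda>E. \<Sum>i\<in>{1..N}. ennreal (2 powr (real k * (\<theta> - th i))) * emeasure (Hrestr M (th i) (S i)) E)"

end

theory Submission
  imports Defs
begin

text \<open>Since every \<open>\<theta>\<^sub>i\<close> is positive, the sets \<open>S\<^sup>i\<close> are \<open>\<mu>\<close>-null and the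
  \<open>f\<^sup>\<sharp>\<close> term of \<open>BN\<close> vanishes; its \<open>L\<^sub>p(\<mm>\<^sub>0)\<close> term is bounded
  by the \<open>L\<^sub>p\<close> parts of the Besov norms.
  In the remaining sum, let \<open>x \<in> S\<^sup>i\<close>, \<open>k \<ge> 2\<close> and \<open>B = B\<^sub>k(x)\<close>. Comparing the values of
  \<open>f\<close> on \<open>S\<^sup>j \<inter> B\<close> with those on \<open>S\<^sup>i \<inter> B\<close> bounds the \<open>\<mm>\<^sub>k\<close>-oscillation on \<open>B\<close> by the
  oscillation with respect to \<open>\<H>\<^sub>\<theta>\<^sub>i\<close> and averages of \<open>\<bar>f(y) - f(z)\<bar>\<close> over
  \<open>y \<in> S\<^sup>i \<inter> B\<close>, \<open>z \<in> S\<^sup>j \<inter> B\<close>. After Jensen's inequality and Fubini's theorem, doubling and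
  Ahlfors regularity turn the latter into the level \<open>k - 1\<close> part of the gluing functional,
  because \<open>y, z \<in> B\<close> only gives \<open>d(y,z) \<le> 2 * 2\<^sup>-\<^sup>k\<close>. Level \<open>k = 1\<close>, where no such part is
  available, is controlled by the \<open>L\<^sub>p\<close> norms alone.\<close>

subsection \<open>Powers of extended nonnegative reals\<close>

lemma epow_0 [simp]: "epow 0 q = 0"
  by (simp add: epow_def)

lemma epow_top [simp]: "epow \<infinity> q = \<infinity>" "epow top q = top"
  by (simp_all add: epow_def)

lemma epow_ennreal: "0 \<le> x \<Longrightarrow> epow (ennreal x) q = ennreal (x powr q)"
  by (simp add: epow_def)

lemma epow_mono:
  assumes "x \<le> y" "0 \<le> q" shows "epow x q \<le> epow y q"
proof (cases y)
  case (real r)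
  then obtain s where s: "x = ennreal s" "0 \<le> s" "s \<le> r"
    using assms by (cases x) (auto simp: top_unique)
  with real assms show ?thesis
    by (simp add: epow_ennreal ennreal_leI powr_mono2)
qed simp

lemma epow_mult: "epow (x * y) q = epow x q * epow y q"
proof (cases "x = 0 \<or> y = 0")
  case False
  then show ?thesis
    by (cases x; cases y)
      (auto simp: epow_ennreal powr_mult ennreal_mult[symmetric] ennreal_mult_top ennreal_top_mult)
qed auto

lemma epow_epow: "epow (epow x a) b = epow x (a * b)"
  by (cases x) (simp_all add: epow_ennreal powr_powr)

lemma epow_1 [simp]: "epow x 1 = x"
  by (cases x) (simp_all add: epow_ennreal)

lemma borel_measurable_epow [measurable (raw)]:
  assumes [measurable]: "g \<in> borel_measurable M"
  shows "(\<lambda>x. epow (g x) q) \<in> borel_measurable M"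
  unfolding epow_def by measurable

text \<open>Bounding every summand by the largest one gives the factor \<open>card I\<close> inside
  the power. This crude constant needs no convexity, so every exponent \<open>0 \<le> q\<close> is
  covered.\<close>

lemma epow_sum_le:
  assumes "finite I" "0 \<le> q"
  shows "epow (\<Sum>j\<in>I. a j) q \<le> ennreal (real (card I) powr q) * (\<Sum>j\<in>I. epow (a j) q)"
proof (cases "I = {}")
  case False
  have "Max (a ` I) \<in> a ` I"
    using assms False by (intro Max_in) auto
  then obtain m where m: "m \<in> I" "Max (a ` I) = a m"
    by auto
  have "a j \<le> a m" if "j \<in> I" for j
    using assms that by (simp flip: m(2))
  then have "(\<Sum>j\<in>I. a j) \<le> of_nat (card I) * a m"
    by (rule sum_bounded_above)
  then have "epow (\<Sum>j\<in>I. a j) q \<le> epow (ennreal (real (card I)) * a m) q"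
    using assms by (intro epow_mono) (auto simp: ennreal_of_nat_eq_real_of_nat)
  also have "\<dots> = ennreal (real (card I) powr q) * epow (a m) q"
    by (simp add: epow_mult epow_ennreal)
  also have "epow (a m) q \<le> (\<Sum>j\<in>I. epow (a j) q)"
    using assms m by (intro member_le_sum) auto
  finally show ?thesis
    by (simp add: mult_left_mono)
qed simp

lemma epow_add_le:
  assumes "0 \<le> q"
  shows "epow (x + y) q \<le> ennreal (2 powr q) * (epow x q + epow y q)"
  using epow_sum_le[of "{True, False}" q "\<lambda>b. if b then x else y"] assms by simp

text \<open>Instead of the sharp Jensen inequality: \<open>t \<le> A + A powr (1 - p) * t powr p\<close>
  for \<open>A > 0\<close>, integrated with \<open>A\<close> the \<open>L\<^sub>p\<close> mean of \<open>g\<close>.\<close>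

lemma epow_integral_le:
  fixes c :: ennreal
  assumes p: "1 \<le> p" and [measurable]: "g \<in> borel_measurable H" "B \<in> sets H"
    and c: "c * emeasure H B \<le> 1"
  shows "epow (c * (\<integral>\<^sup>+x. g x * indicator B x \<partial>H)) p
    \<le> ennreal (2 powr p) * (c * (\<integral>\<^sup>+x. epow (g x) p * indicator B x \<partial>H))"
    (is "epow ?L p \<le> _ * ?R")
proof -
  have young: "g x \<le> ennreal A + ennreal (A powr (1 - p)) * epow (g x) p" if A: "A > 0" for A x
  proof (cases "g x")
    case (real t)
    have "t \<le> A + A powr (1 - p) * t powr p"
    \<comment> \<open>Below \<open>A\<close> the first term suffices. Above \<open>A\<close> the
      exponent \<open>1 - p\<close> is nonpositive, so \<open>t powr (1 - p)\<close> is at most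
      \<open>A powr (1 - p)\<close>.\<close>
    proof (cases "t \<le> A")
      case True
      then show ?thesis
        using A real by (simp add: add_increasing2)
    next
      case False
      then have "t = t powr (1 - p) * t powr p"
        using A by (simp flip: powr_add)
      also have "\<dots> \<le> A powr (1 - p) * t powr p"
        using False A p by (intro mult_right_mono powr_mono2') auto
      finally show ?thesis
        using A by simp
    qed
    then show ?thesis
      using real A
      by (simp add: epow_ennreal ennreal_leI flip: ennreal_mult ennreal_plus)
  qed (use A in \<open>simp add: ennreal_mult_top\<close>)
  have *: "?L \<le> ennreal A + ennreal (A powr (1 - p)) * ?R" if A: "A > 0" for A
  proof -
    have "(\<integral>\<^sup>+x. g x * indicator B x \<partial>H)
      \<le> (\<integral>\<^sup>+x. ennreal A * indicator B x
            + ennreal (A powr (1 - p)) * (epow (g x) p * indicator B x) \<partial>H)"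
      by (intro nn_integral_mono) (auto split: split_indicator simp: young[OF A])
    also have "\<dots> = ennreal A * emeasure H B
        + ennreal (A powr (1 - p)) * (\<integral>\<^sup>+x. epow (g x) p * indicator B x \<partial>H)"
      by (simp add: nn_integral_add nn_integral_cmult)
    finally have "?L \<le> c * \<dots>"
      by (rule mult_left_mono) simp
    also have "\<dots> = ennreal A * (c * emeasure H B) + ennreal (A powr (1 - p)) * ?R"
      by (simp add: algebra_simps)
    also have "\<dots> \<le> ennreal A * 1 + ennreal (A powr (1 - p)) * ?R"
      using c by (intro add_mono mult_left_mono) auto
    finally show ?thesis by simp
  qed
  show ?thesis
  proof (cases ?R)
    case (real r)
    show ?thesis
    proof (cases "r = 0")
      case True
      \<comment> \<open>A vanishing mean is not an admissible value of \<open>A\<close>. Here the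
        second term is zero for every \<open>A > 0\<close>, and \<open>A\<close> is sent to
        0.\<close>
      have "?L \<le> 0 + ennreal e" if "e > 0" for e
        using *[OF that] real True by simp
      then have "?L \<le> 0"
        by (rule ennreal_le_epsilon)
      then have "?L = 0"
        by (simp only: le_zero_eq)
      then show ?thesis
        by (simp only: epow_0) simp
    next
      case False
      \<comment> \<open>For this \<open>A\<close> both terms of the bound equal \<open>A\<close>;
        their sum \<open>2 * A\<close> produces the constant \<open>2 powr p\<close>.\<close>
      define A where "A = r powr (1/p)"
      have A: "A > 0" "A powr p = r"
        using False real p by (auto simp: A_def powr_powr)
      have "A powr (1 - p) * A powr p = A"
        using A(1) by (simp flip: powr_add)
      then have "A powr (1 - p) * r = A"
        by (simp only: A(2))
      then have "?L \<le> ennreal A + ennreal A"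
        using *[OF A(1)] real by (simp flip: ennreal_mult)
      also have "\<dots> = ennreal (2 * A)"
        using A by (simp flip: ennreal_plus)
      finally have "epow ?L p \<le> epow (ennreal (2 * A)) p"
        using p by (intro epow_mono) auto
      also have "\<dots> = ennreal (2 powr p) * ennreal r"
        using A real(1) by (simp add: epow_ennreal powr_mult flip: ennreal_mult)
      finally show ?thesis
        using real by simp
    qed
  qed (simp add: ennreal_mult_top)
qed

subsection \<open>Measures and oscillations on separable metric spaces\<close>

text \<open>A finite weighted sum of measures is countably additive, so \<open>measure_of\<close>
  returns it unchanged. The integral bound holds for arbitrary \<open>g\<close>, measurable or not:
  it is checked on the simple functions below \<open>g\<close>, whose supremum defines the integral.
  Oscillations can therefore be integrated against \<open>m\<close> without a measurability
  proof.\<close>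

lemma
  fixes H :: "'i \<Rightarrow> 'a::topological_space measure" and c :: "'i \<Rightarrow> ennreal"
  assumes H: "\<And>i. i \<in> I \<Longrightarrow> sets (H i) = sets borel" and "finite I"
    and m: "m = measure_of UNIV (sets borel) (\<lambda>E. \<Sum>i\<in>I. c i * emeasure (H i) E)"
  shows sets_measure_of_sum: "sets m = sets borel"
    and emeasure_measure_of_sum: "E \<in> sets borel \<Longrightarrow> emeasure m E = (\<Sum>i\<in>I. c i * emeasure (H i) E)"
    and nn_integral_measure_of_sum_le:
      "(\<integral>\<^sup>+x. g x \<partial>m) \<le> (\<Sum>i\<in>I. c i * (\<integral>\<^sup>+x. g x \<partial>H i))"
proof -
  show sets_m: "sets m = sets borel"
    unfolding m by (subst sets_measure_of) (auto simp: sets.sigma_sets_eq[of borel, simplified])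
  have "countably_additive (sets m) (\<lambda>E. \<Sum>i\<in>I. c i * emeasure (H i) E)"
  proof (rule countably_additiveI)
    fix A :: "nat \<Rightarrow> 'a set"
    assume A: "range A \<subseteq> sets m" "disjoint_family A"
    have "(\<Sum>n. c i * emeasure (H i) (A n)) = c i * emeasure (H i) (\<Union>n. A n)" if "i \<in> I" for i
      using A H[OF that] sets_m by (simp add: suminf_emeasure)
    then show "(\<Sum>n. \<Sum>i\<in>I. c i * emeasure (H i) (A n)) = (\<Sum>i\<in>I. c i * emeasure (H i) (\<Union>n. A n))"
      by (subst suminf_sum) auto
  qed
  then show emeasure_m: "emeasure m E = (\<Sum>i\<in>I. c i * emeasure (H i) E)"
    if "E \<in> sets borel" for E
    using that sets_m by (intro emeasure_measure_of[OF m]) (auto simp: positive_def)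
  have space: "space m = UNIV" "i \<in> I \<Longrightarrow> space (H i) = UNIV" for i
    using sets_eq_imp_space_eq[OF sets_m] sets_eq_imp_space_eq[OF H] by auto
  have "integral\<^sup>S m s \<le> (\<Sum>i\<in>I. c i * (\<integral>\<^sup>+x. g x \<partial>H i))"
    if s: "simple_function m s" "s \<le> g" for s
  proof -
    have s': "simple_function (H i) s" if "i \<in> I" for i
      using s(1) H[OF that] sets_m space that by (auto simp: simple_function_def)
    have "integral\<^sup>S m s = (\<Sum>y\<in>range s. \<Sum>i\<in>I. c i * (y * emeasure (H i) (s -` {y})))"
      unfolding simple_integral_def using s(1) sets_m
      by (auto simp: space emeasure_m simple_function_def sum_distrib_left ac_simps intro!: sum.cong)
    also have "\<dots> = (\<Sum>i\<in>I. c i * integral\<^sup>S (H i) s)"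
      unfolding simple_integral_def by (subst sum.swap) (auto simp: space sum_distrib_left intro!: sum.cong)
    also have "\<dots> \<le> (\<Sum>i\<in>I. c i * (\<integral>\<^sup>+x. g x \<partial>H i))"
      using s(2) s' by (intro sum_mono mult_left_mono)
        (auto simp: le_fun_def simp flip: nn_integral_eq_simple_integral intro!: nn_integral_mono)
    finally show ?thesis .
  qed
  then show "(\<integral>\<^sup>+x. g x \<partial>m) \<le> (\<Sum>i\<in>I. c i * (\<integral>\<^sup>+x. g x \<partial>H i))"
    unfolding nn_integral_def by (intro SUP_least) auto
qed

text \<open>This is Lindelof's theorem with radii depending on the centre, the form in which local
  properties such as finite mass or nullity are made global.\<close>

lemma countable_ball_cover:
  fixes r :: "'a::{metric_space,second_countable_topology} \<Rightarrow> real"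
  assumes "\<And>x. 0 < r x"
  obtains X where "countable X" "(\<Union>x\<in>X. ball x (r x)) = UNIV"
proof -
  obtain F where F: "F \<subseteq> range (\<lambda>x. ball x (r x))" "countable F" "\<Union>F = \<Union>(range (\<lambda>x. ball x (r x)))"
    by (rule Lindelof[of "range (\<lambda>x. ball x (r x))"]) auto
  then obtain X where X: "countable X" "F = (\<lambda>x. ball x (r x)) ` X"
    by (meson countable_subset_image)
  have "x \<in> ball x (r x)" for x
    using assms[of x] by simp
  then have "(\<Union>x\<in>X. ball x (r x)) = UNIV"
    using F(3) unfolding X(2) by blast
  with X(1) show ?thesis
    by (rule that)
qed

text \<open>Countably many balls of finite mass cover the space. Sigma-finiteness is what Fubini's
  theorem and the measurability of parameter integrals rely on below.\<close>

lemma sigma_finite_measure_locally_finite: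
  fixes m :: "'a::{metric_space,second_countable_topology} measure"
  assumes m: "sets m = sets borel" and fin: "\<And>x. \<exists>r>0. emeasure m (cball x r) < \<infinity>"
  shows "sigma_finite_measure m"
proof
  obtain r where r: "0 < r x" "emeasure m (cball x (r x)) < \<infinity>" for x
    using fin by metis
  obtain X where X: "countable X" "(\<Union>x\<in>X. ball x (r x)) = UNIV"
    using r(1) by (rule countable_ball_cover)
  have "(\<Union>x\<in>X. cball x (r x)) = UNIV"
    using X(2) ball_subset_cball by blast
  then show "\<exists>A. countable A \<and> A \<subseteq> sets m \<and> \<Union>A = space m \<and> (\<forall>a\<in>A. emeasure m a \<noteq> \<infinity>)"
    using X(1) r(2) m sets_eq_imp_space_eq[OF m]
    by (intro exI[of _ "(\<lambda>x. cball x (r x)) ` X"]) (auto simp: less_top)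
qed

text \<open>Membership in a ball is a condition on the distance, hence jointly measurable in centre
  and point. This is what allows integration over the centre.\<close>

lemma borel_measurable_indicator_cball [measurable (raw)]:
  fixes f g :: "'b \<Rightarrow> 'a::{metric_space,second_countable_topology}"
  assumes [measurable]: "f \<in> borel_measurable N" "g \<in> borel_measurable N"
  shows "(\<lambda>w. indicator (cball (f w) r) (g w) :: ennreal) \<in> borel_measurable N"
proof -
  have "(\<lambda>w. indicator (cball (f w) r) (g w) :: ennreal) = (\<lambda>w. if dist (f w) (g w) \<le> r then 1 else 0)"
    by (auto simp: fun_eq_iff)
  then show ?thesis
    by simp
qed

lemma borel_measurable_emeasure_cball:
  fixes m :: "'a::{metric_space,second_countable_topology} measure"
  assumes m [measurable_cong]: "sets m = sets borel" and "sigma_finite_measure m"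
  shows "(\<lambda>x. emeasure m (cball x r)) \<in> borel_measurable borel"
proof -
  interpret sigma_finite_measure m by fact
  have "(\<lambda>x. emeasure m (cball x r)) = (\<lambda>x. \<integral>\<^sup>+y. indicator (cball x r) y \<partial>m)"
    using m by (auto simp: fun_eq_iff)
  then show ?thesis
    by (simp only:) measurable
qed

section \<open>Averages and the oscillation functional\<close>

lemma Av_const_le:
  assumes "G \<in> sets m"
  shows "Av m G (\<lambda>_. e) \<le> e"
\<comment> \<open>The average of a constant is 0 when \<open>G\<close> has mass 0 or infinity, so
  equality can fail.\<close>
proof (cases "emeasure m G = \<infinity>")
  case False
  then show ?thesis
    using assms by (auto simp: Av_def nn_integral_cmult less_top ennreal_mult_divide_eq)
qed (simp add: Av_def)

lemma Av_add:
  assumes "G \<in> sets m" "g \<in> borel_measurable m" "h \<in> borel_measurable m"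
  shows "Av m G (\<lambda>x. g x + h x) = Av m G g + Av m G h"
  using assms by (simp add: Av_def distrib_right nn_integral_add add_divide_distrib_ennreal)

lemma Av_mono: "(\<And>x. x \<in> G \<Longrightarrow> g x \<le> h x) \<Longrightarrow> Av m G g \<le> Av m G h"
  unfolding Av_def
  by (auto intro!: divide_right_mono_ennreal nn_integral_mono split: split_indicator)

text \<open>Moving \<open>c\<close> to a rational number within distance \<open>e\<close> changes
  the average by at most \<open>e\<close>. The infimum becomes countable, which makes the
  oscillation on \<open>cball x r\<close> measurable in \<open>x\<close>.\<close>

lemma Eosc_eq_rational:
  assumes [measurable]: "G \<in> sets m" "g \<in> borel_measurable m"
  shows "Eosc m g G = (INF c\<in>\<rat>. Av m G (\<lambda>y. ennreal \<bar>g y - c\<bar>))"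
proof (rule antisym)
  show "Eosc m g G \<le> (INF c\<in>\<rat>. Av m G (\<lambda>y. ennreal \<bar>g y - c\<bar>))"
    unfolding Eosc_def by (rule INF_superset_mono) auto
  have "(INF c\<in>\<rat>. Av m G (\<lambda>y. ennreal \<bar>g y - c\<bar>)) \<le> Av m G (\<lambda>y. ennreal \<bar>g y - c\<bar>)" for c
  proof (rule ennreal_le_epsilon)
    fix e :: real assume e: "0 < e"
    obtain q where q: "q \<in> \<rat>" "c < q" "q < c + e"
      using Rats_dense_in_real[of c "c + e"] e by auto
    have "Av m G (\<lambda>y. ennreal \<bar>g y - q\<bar>) \<le> Av m G (\<lambda>y. ennreal \<bar>g y - c\<bar> + ennreal e)"
      using q by (intro Av_mono) (auto simp flip: ennreal_plus intro!: ennreal_leI)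
    also have "\<dots> \<le> Av m G (\<lambda>y. ennreal \<bar>g y - c\<bar>) + ennreal e"
      by (simp add: Av_add Av_const_le add_left_mono)
    finally show "(INF c\<in>\<rat>. Av m G (\<lambda>y. ennreal \<bar>g y - c\<bar>)) \<le> Av m G (\<lambda>y. ennreal \<bar>g y - c\<bar>) + ennreal e"
      using q by (meson INF_lower2)
  qed
  then show "(INF c\<in>\<rat>. Av m G (\<lambda>y. ennreal \<bar>g y - c\<bar>)) \<le> Eosc m g G"
    unfolding Eosc_def by (intro INF_greatest)
qed

lemma borel_measurable_Eosc:
  fixes m :: "'a::{metric_space,second_countable_topology} measure"
  assumes m [measurable_cong]: "sets m = sets borel" and "sigma_finite_measure m"
    and [measurable]: "f \<in> borel_measurable borel"
  shows "(\<lambda>x. Eosc m f (cball x r)) \<in> borel_measurable borel"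
proof -
  interpret sigma_finite_measure m by fact
  have [measurable]: "(\<lambda>x. emeasure m (cball x r)) \<in> borel_measurable borel"
    using assms by (intro borel_measurable_emeasure_cball)
  have "(\<lambda>x. Eosc m f (cball x r)) = (\<lambda>x. INF c\<in>\<rat>. Av m (cball x r) (\<lambda>y. ennreal \<bar>f y - c\<bar>))"
    by (intro ext Eosc_eq_rational) (auto simp: m)
  also have "\<dots> \<in> borel_measurable borel"
    unfolding Av_def by (intro borel_measurable_INF countable_rat) measurable
  finally show ?thesis .
qed

text \<open>Every competing constant in \<open>Eosc m f B\<close> is compared with the values of \<open>f\<close> on the support of
  \<open>H i\<close>, so that only the oscillation with respect to \<open>H i\<close> and differences across
  two different measures remain.\<close>

lemma Eosc_sum_le:
  fixes H :: "'i \<Rightarrow> 'a::topological_space measure" and a :: "'i \<Rightarrow> real"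
  assumes I: "finite I" "i \<in> I" and H: "\<And>j. j \<in> I \<Longrightarrow> sets (H j) = sets borel"
    and sets_m [measurable_cong]: "sets m = sets borel"
    and m: "\<And>E. E \<in> sets borel \<Longrightarrow> emeasure m E = (\<Sum>j\<in>I. ennreal (a j) * emeasure (H j) E)"
    and int_m: "\<And>g. (\<integral>\<^sup>+x. g x \<partial>m) \<le> (\<Sum>j\<in>I. ennreal (a j) * (\<integral>\<^sup>+x. g x \<partial>H j))"
    and a: "\<And>j. j \<in> I \<Longrightarrow> 0 < a j"
    and B [measurable]: "B \<in> sets borel" and f [measurable]: "f \<in> borel_measurable borel"
    and D: "emeasure m B = ennreal D" "0 < D" and h: "emeasure (H i) B = ennreal h" "0 < h"
    and sf: "\<And>j. j \<in> I \<Longrightarrow> sigma_finite_measure (H j)"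
  shows "Eosc m f B \<le> of_nat (card I) * Eosc (H i) f B +
    (\<Sum>j\<in>I - {i}. ennreal (a j / D) * (\<integral>\<^sup>+z. ennreal (1 / h) *
       (\<integral>\<^sup>+y. ennreal \<bar>f y - f z\<bar> * indicator B y \<partial>H i) * indicator B z \<partial>H j))"
    (is "_ \<le> _ + ?T")
proof -
  interpret Hi: sigma_finite_measure "H i"
    using sf I by auto
  note [measurable_cong] = H[OF I(2)]
  let ?T' = "\<lambda>j z. ennreal (1 / h) * (\<integral>\<^sup>+y. ennreal \<bar>f y - f z\<bar> * indicator B y \<partial>H i)"
  have mass: "ennreal (a j / D) * emeasure (H j) B \<le> 1" if "j \<in> I" for j
  proof -
    have "ennreal (a j) * emeasure (H j) B \<le> ennreal D"
      unfolding D(1)[symmetric] m[OF B] using I that by (intro member_le_sum) auto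
    then have "ennreal (1 / D) * (ennreal (a j) * emeasure (H j) B) \<le> ennreal (1 / D) * ennreal D"
      by (intro mult_left_mono) auto
    also have "\<dots> = 1"
      using D(2) by (simp flip: ennreal_mult)
    also have "ennreal (1 / D) * (ennreal (a j) * emeasure (H j) B) = ennreal (a j / D) * emeasure (H j) B"
      using D(2) a[OF that] by (simp add: mult.assoc[symmetric] ennreal_mult[symmetric])
    finally show ?thesis .
  qed
  have Av_i: "Av (H i) B g = ennreal (1 / h) * (\<integral>\<^sup>+x. g x * indicator B x \<partial>H i)" for g
    using h by (simp add: Av_def divide_ennreal_def inverse_ennreal inverse_eq_divide mult.commute)
  have main: "Eosc m f B \<le> of_nat (card I) * Av (H i) B (\<lambda>y. ennreal \<bar>f y - c\<bar>) + ?T" for c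
  proof -
    define A where "A = Av (H i) B (\<lambda>y. ennreal \<bar>f y - c\<bar>)"
    let ?g = "\<lambda>j. ennreal (a j / D) * (\<integral>\<^sup>+z. ennreal \<bar>f z - c\<bar> * indicator B z \<partial>H j)"
    have "Eosc m f B \<le> Av m B (\<lambda>y. ennreal \<bar>f y - c\<bar>)"
      unfolding Eosc_def by (rule INF_lower) simp
    also have "\<dots> = ennreal (1 / D) * (\<integral>\<^sup>+x. ennreal \<bar>f x - c\<bar> * indicator B x \<partial>m)"
      using D by (simp add: Av_def divide_ennreal_def inverse_ennreal inverse_eq_divide mult.commute)
    also have "\<dots> \<le> ennreal (1 / D) *
        (\<Sum>j\<in>I. ennreal (a j) * (\<integral>\<^sup>+z. ennreal \<bar>f z - c\<bar> * indicator B z \<partial>H j))"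
      by (intro mult_left_mono int_m) auto
    also have "\<dots> = (\<Sum>j\<in>I. ?g j)"
      using D(2) a unfolding sum_distrib_left
      by (intro sum.cong) (simp_all add: mult.assoc[symmetric] ennreal_mult[symmetric] less_imp_le)
    also have "\<dots> = ?g i + (\<Sum>j\<in>I - {i}. ?g j)"
      using I by (simp add: sum.remove)
    also have "\<dots> \<le> A + (\<Sum>j\<in>I - {i}. ennreal (a j / D) * (\<integral>\<^sup>+z. ?T' j z * indicator B z \<partial>H j) + A)"
    proof (intro add_mono sum_mono)
      have "ennreal (a i / D) * ennreal h \<le> 1"
        using mass[OF I(2)] h by simp
      then have "a i / D \<le> 1 / h"
        using h D a[OF I(2)] by (simp add: ennreal_mult[symmetric] field_simps)
      then show "?g i \<le> A"
        unfolding A_def Av_i by (intro mult_right_mono ennreal_leI) auto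
    next
      fix j assume "j \<in> I - {i}"
      then have j: "j \<in> I" by simp
      note [measurable_cong] = H[OF j]
      \<comment> \<open>The triangle inequality through \<open>f y\<close> is averaged over
        \<open>y\<close> in \<open>B\<close> with respect to \<open>H i\<close>; the constant
        \<open>c\<close> then survives only in \<open>A\<close>.\<close>
      have tri: "ennreal \<bar>f z - c\<bar> \<le> ?T' j z + A" for z
      proof -
        have "ennreal \<bar>f z - c\<bar> = Av (H i) B (\<lambda>_. ennreal \<bar>f z - c\<bar>)"
          using h by (simp add: Av_def nn_integral_cmult ennreal_mult_divide_eq H[OF I(2)])
        also have "\<dots> \<le> Av (H i) B (\<lambda>y. ennreal \<bar>f y - f z\<bar> + ennreal \<bar>f y - c\<bar>)"
          by (intro Av_mono) (auto simp flip: ennreal_plus intro!: ennreal_leI)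
        also have "\<dots> = ?T' j z + A"
          by (subst Av_add) (auto simp: A_def Av_i H[OF I(2)])
        finally show ?thesis .
      qed
      have "?g j \<le> ennreal (a j / D) * (\<integral>\<^sup>+z. ?T' j z * indicator B z + A * indicator B z \<partial>H j)"
        by (intro mult_left_mono nn_integral_mono) (auto simp: tri split: split_indicator)
      also have "\<dots> = ennreal (a j / D) * (\<integral>\<^sup>+z. ?T' j z * indicator B z \<partial>H j)
          + A * (ennreal (a j / D) * emeasure (H j) B)"
        by (subst nn_integral_add) (auto simp: nn_integral_cmult distrib_left ac_simps H[OF j])
      also have "\<dots> \<le> ennreal (a j / D) * (\<integral>\<^sup>+z. ?T' j z * indicator B z \<partial>H j) + A * 1"
        by (intro add_mono mult_left_mono mass j) auto
      finally show "?g j \<le> ennreal (a j / D) * (\<integral>\<^sup>+z. ?T' j z * indicator B z \<partial>H j) + A"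
        by simp
    qed
    also have "\<dots> = of_nat (Suc (card (I - {i}))) * A + ?T"
      by (simp add: sum.distrib distrib_left distrib_right ac_simps)
    also have "Suc (card (I - {i})) = card I"
      using I by (rule card_Suc_Diff1)
    finally show ?thesis
      by (simp add: A_def)
  qed
  show ?thesis
  proof (cases "Eosc (H i) f B = \<infinity>")
    case True
    have "card I \<noteq> 0" using I by auto
    with True show ?thesis by (simp add: ennreal_mult_top)
  next
    case False
    have n: "0 < real (card I)" using I by (auto simp: card_gt_0_iff)
    show ?thesis
    proof (rule ennreal_le_epsilon)
      fix e :: real assume e: "0 < e"
      \<comment> \<open>Finiteness gives the strict inequality, hence a nearly optimal
        \<open>c\<close>. The error is divided by \<open>card I\<close> because \<open>main\<close>
        multiplies it by that number.\<close>
      have "Eosc (H i) f B < Eosc (H i) f B + ennreal (e / card I)"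
        using False e n
        by (cases "Eosc (H i) f B") (auto simp: ennreal_less_iff simp flip: ennreal_plus)
      then obtain c where c: "Av (H i) B (\<lambda>y. ennreal \<bar>f y - c\<bar>) < Eosc (H i) f B + ennreal (e / card I)"
        unfolding Eosc_def[of "H i"] INF_less_iff by auto
      have "Eosc m f B \<le> of_nat (card I) * Av (H i) B (\<lambda>y. ennreal \<bar>f y - c\<bar>) + ?T"
        by (rule main)
      also have "\<dots> \<le> of_nat (card I) * (Eosc (H i) f B + ennreal (e / card I)) + ?T"
        using c by (intro add_right_mono mult_left_mono) auto
      also have "\<dots> = of_nat (card I) * Eosc (H i) f B + ?T + ennreal e"
        using n e by (simp add: distrib_left ac_simps ennreal_of_nat_eq_real_of_nat flip: ennreal_mult)
      finally show "Eosc m f B \<le> of_nat (card I) * Eosc (H i) f B + ?T + ennreal e" .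
    qed
  qed
qed

subsection \<open>Regular measures on a doubling space\<close>

text \<open>Doubling is recorded up to radius 1 only, the range of scales in the sums to be
  estimated. The normalisation \<open>1 \<le> Cd\<close> lets higher powers of \<open>Cd\<close>
  absorb lower ones.\<close>

locale doubling_measure =
  fixes M :: "'a::{metric_space,second_countable_topology} measure" and Cd :: real
  assumes sets_M [measurable_cong]: "sets M = sets borel"
    and finite_cball: "emeasure M (cball x r) < \<infinity>"
    and pos_cball: "0 < r \<Longrightarrow> 0 < emeasure M (cball x r)"
    and doubling: "0 < r \<Longrightarrow> r \<le> 1 \<Longrightarrow> emeasure M (cball x (2 * r)) \<le> ennreal Cd * emeasure M (cball x r)"
    and Cd_ge_1: "1 \<le> Cd"
begin

sublocale sigma_finite_measure M
  using sets_M by (rule sigma_finite_measure_locally_finite) (use finite_cball zero_less_one in blast)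

definition V :: "real \<Rightarrow> 'a \<Rightarrow> real" where
  "V r x = measure M (cball x r)"

lemma emeasure_cball: "emeasure M (cball x r) = ennreal (V r x)"
  unfolding V_def using finite_cball[of x r] by (intro emeasure_eq_ennreal_measure) (simp add: less_top)

lemma V_pos: "0 < r \<Longrightarrow> 0 < V r x"
  using pos_cball[of r x] unfolding emeasure_cball by simp

lemma V_nonneg [simp]: "0 \<le> V r x"
  by (simp add: V_def)

lemma borel_measurable_V [measurable]: "V r \<in> borel_measurable borel"
proof -
  have [measurable]: "(\<lambda>x. emeasure M (cball x r)) \<in> borel_measurable borel"
    using sets_M sigma_finite_measure_axioms by (rule borel_measurable_emeasure_cball)
  show ?thesis
    unfolding V_def measure_def by measurable
qed

lemma V_mono: "cball x r \<subseteq> cball y s \<Longrightarrow> V r x \<le> V s y"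
proof -
  assume "cball x r \<subseteq> cball y s"
  then have "emeasure M (cball x r) \<le> emeasure M (cball y s)"
    by (rule emeasure_mono) (simp add: sets_M)
  then show ?thesis
    by (simp add: emeasure_cball)
qed

lemma V_double:
  assumes "0 < r" "r \<le> 1"
  shows "V (2 * r) x \<le> Cd * V r x"
proof -
  have "ennreal (V (2 * r) x) \<le> ennreal (Cd * V r x)"
    using doubling[OF assms, of x] Cd_ge_1 by (simp add: emeasure_cball ennreal_mult)
  then show ?thesis
    using Cd_ge_1 by (subst (asm) ennreal_le_iff) auto
qed

text \<open>The ball about \<open>y\<close> lies in the ball of twice the radius about
  \<open>x\<close>. In the integrals below this lets the centre be exchanged for a point of the
  ball.\<close>

lemma V_double_near:
  assumes "dist x y \<le> r" "0 < r" "r \<le> 1"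
  shows "V r y \<le> Cd * V r x"
proof -
  have "V r y \<le> V (2 * r) x"
  proof (intro V_mono subsetI)
    fix u assume "u \<in> cball y r"
    then show "u \<in> cball x (2 * r)"
      using assms(1) dist_triangle[of x u y] by simp
  qed
  then show ?thesis
    using V_double[OF assms(2,3), of x] by simp
qed

text \<open>The lower bound is only required almost everywhere: for the codimensional Hausdorff
  measure of a set it is available at the points of the set only.\<close>

definition regular :: "real \<Rightarrow> real \<Rightarrow> real \<Rightarrow> 'a measure \<Rightarrow> bool" where
  "regular t k K H \<longleftrightarrow> sets H = sets borel \<and> 0 < k \<and> 0 < K \<and>
     (AE x in H. \<forall>r\<in>{0<..1}. ennreal (k * V r x * r powr - t) \<le> emeasure H (cball x r)) \<and>
     (\<forall>x. \<forall>r\<in>{0<..1/2}. emeasure H (cball x r) \<le> ennreal (K * V r x * r powr - t))"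

lemma regularD:
  assumes "regular t k K H"
  shows "sets H = sets borel" "0 < k" "0 < K"
    "AE x in H. \<forall>r\<in>{0<..1}. ennreal (k * V r x * r powr - t) \<le> emeasure H (cball x r)"
    "0 < r \<Longrightarrow> r \<le> 1/2 \<Longrightarrow> emeasure H (cball x r) \<le> ennreal (K * V r x * r powr - t)"
  using assms by (auto simp: regular_def)

lemma regular_sigma_finite:
  assumes "regular t k K H"
  shows "sigma_finite_measure H"
proof (rule sigma_finite_measure_locally_finite)
  show "\<exists>r>0. emeasure H (cball x r) < \<infinity>" for x
    using regularD(5)[OF assms, of "1/2" x]
    by (intro exI[of _ "1/2"]) (simp add: le_less_trans)
qed (rule regularD(1)[OF assms])

text \<open>Only centres \<open>x\<close> within \<open>r\<close> of \<open>y\<close> contribute,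
  and for these doubling replaces \<open>V r x\<close> by \<open>V r y\<close>; upper regularity
  then bounds the mass of \<open>cball y r\<close>. The case \<open>n = 1\<close> serves the
  \<open>L_p\<close> terms, \<open>n = 2\<close> the gluing terms.\<close>

lemma kernel_integral_le:
  assumes H: "regular t k K H" and r: "0 < r" "r \<le> 1/2"
  shows "(\<integral>\<^sup>+x. ennreal (1 / V r x ^ n) * indicator (cball x r) y \<partial>H)
    \<le> ennreal (Cd ^ n * K * r powr - t * V r y / V r y ^ n)"
proof -
  have V: "0 < V r x" for x
    using r by (intro V_pos)
  have "(\<integral>\<^sup>+x. ennreal (1 / V r x ^ n) * indicator (cball x r) y \<partial>H)
      \<le> (\<integral>\<^sup>+x. ennreal (Cd ^ n / V r y ^ n) * indicator (cball y r) x \<partial>H)"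
  proof (rule nn_integral_mono)
    fix x
    have "1 / V r x ^ n \<le> Cd ^ n / V r y ^ n" if "dist x y \<le> r"
    proof -
      have "V r y ^ n \<le> (Cd * V r x) ^ n"
        using that r by (intro power_mono V_double_near) auto
      then show ?thesis
        using V[of x] V[of y] by (simp add: field_simps)
    qed
    then show "ennreal (1 / V r x ^ n) * indicator (cball x r) y \<le> ennreal (Cd ^ n / V r y ^ n) * indicator (cball y r) x"
      by (auto simp: dist_commute intro!: ennreal_leI split: split_indicator)
  qed
  also have "\<dots> = ennreal (Cd ^ n / V r y ^ n) * emeasure H (cball y r)"
    by (simp add: nn_integral_cmult_indicator regularD(1)[OF H])
  also have "\<dots> \<le> ennreal (Cd ^ n / V r y ^ n) * ennreal (K * V r y * r powr - t)"
    by (intro mult_left_mono regularD(5)[OF H] r) auto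
  also have "\<dots> = ennreal (Cd ^ n * K * r powr - t * V r y / V r y ^ n)"
    using regularD(3)[OF H] Cd_ge_1 by (simp add: ennreal_mult[symmetric] field_simps)
  finally show ?thesis .
qed

lemma inverse_V_le_weight:
  assumes "dist y z \<le> (1/2) ^ Suc k"
  shows "ennreal (1 / V ((1/2) ^ Suc (Suc k)) y) \<le> ennreal (Cd\<^sup>2) * weight M (Suc k) y z"
proof -
  define r :: real where "r = (1/2) ^ Suc (Suc k)"
  have r: "0 < r" "2 * r \<le> 1" "(1/2) ^ Suc k = 2 * r"
    using power_le_one[of "1/2::real" k] by (auto simp: r_def)
  have V: "0 < V r y" "0 < V (2 * r) y" "0 < V (2 * r) z"
    using r by (auto intro!: V_pos)
  have 1: "V (2 * r) y \<le> Cd * V r y"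
    using r by (intro V_double) auto
  have "V (2 * r) z \<le> Cd * V (2 * r) y"
    using r assms by (intro V_double_near) auto
  also have "\<dots> \<le> Cd * (Cd * V r y)"
    using 1 Cd_ge_1 by (intro mult_left_mono) auto
  finally have 2: "V (2 * r) z \<le> Cd * (Cd * V r y)" .
  have "V (2 * r) y * V (2 * r) z \<le> (Cd * V r y) * (Cd * (Cd * V r y))"
    using 1 2 V Cd_ge_1 by (intro mult_mono) auto
  \<comment> \<open>The two estimates give the third power of \<open>Cd\<close>; one more factor
    turns the bound into a perfect square.\<close>
  also have "\<dots> \<le> Cd * ((Cd * V r y) * (Cd * (Cd * V r y)))"
    using V Cd_ge_1 mult_right_mono[of 1 Cd "(Cd * V r y) * (Cd * (Cd * V r y))"] by simp
  also have "\<dots> = (Cd\<^sup>2 * V r y)\<^sup>2"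
    by (simp add: power2_eq_square)
  finally have "sqrt (V (2 * r) y * V (2 * r) z) \<le> Cd\<^sup>2 * V r y"
    using V Cd_ge_1 by (intro real_le_lsqrt) auto
  then have "1 / V r y \<le> Cd\<^sup>2 * (1 / sqrt (V (2 * r) y * V (2 * r) z))"
    using V by (simp add: field_simps)
  then have "ennreal (1 / V r y) \<le> ennreal (Cd\<^sup>2) * ennreal (1 / sqrt (V (2 * r) y * V (2 * r) z))"
    using V by (simp add: ennreal_mult[symmetric] ennreal_leI)
  also have "ennreal (1 / sqrt (V (2 * r) y * V (2 * r) z)) = weight M (Suc k) y z"
    using V unfolding weight_def r(3) emeasure_cball
    by (simp add: epow_ennreal powr_half_sqrt inverse_ennreal inverse_eq_divide flip: ennreal_mult)
  finally show ?thesis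
    unfolding r_def .
qed

text \<open>Integrating over the centre \<open>x\<close> first leaves a multiple of
  \<open>1 / V r y\<close>, which is comparable to the weight one level coarser. That level is the
  right one, since two points of a ball of radius \<open>r\<close> are at distance at most
  \<open>2 * r\<close>. The kernel and the weight contribute a factor \<open>Cd\<^sup>2\<close>
  each.\<close>

lemma gluing_integral_le:
  assumes H: "regular t k K H" and H': "regular t' k' K' H'"
    and f [measurable]: "f \<in> borel_measurable borel"
    and r: "r = (1/2) ^ Suc (Suc n)"
  shows "(\<integral>\<^sup>+x. ennreal (1 / (V r x)\<^sup>2) * (\<integral>\<^sup>+z. (\<integral>\<^sup>+y. epow (ennreal \<bar>f y - f z\<bar>) p
        * indicator (cball x r) y \<partial>H) * indicator (cball x r) z \<partial>H') \<partial>H)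
    \<le> ennreal (Cd ^ 4 * K * r powr - t) *
      (\<integral>\<^sup>+z. \<integral>\<^sup>+y. indicator {(y,z). dist y z \<le> (1/2)^(Suc n)} (y,z) *
         weight M (Suc n) y z * epow (ennreal \<bar>f y - f z\<bar>) p \<partial>H \<partial>H')"
proof -
  interpret H: sigma_finite_measure H by (rule regular_sigma_finite[OF H])
  interpret H': sigma_finite_measure H' by (rule regular_sigma_finite[OF H'])
  interpret HH: pair_sigma_finite H H ..
  interpret HH': pair_sigma_finite H H' ..
  note [measurable_cong] = regularD(1)[OF H] regularD(1)[OF H']
  have r0: "0 < r" "r \<le> 1/2" and r2: "(1/2) ^ Suc n = 2 * r"
    using power_le_one[of "1/2::real" n] by (auto simp: r)
  let ?e = "\<lambda>y z. epow (ennreal \<bar>f y - f z\<bar>) p"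
  let ?G = "\<lambda>x y z. ennreal (1 / (V r x)\<^sup>2) * (?e y z * indicator (cball x r) y * indicator (cball x r) z)"
  have "(\<integral>\<^sup>+x. ennreal (1 / (V r x)\<^sup>2) * (\<integral>\<^sup>+z. (\<integral>\<^sup>+y. ?e y z * indicator (cball x r) y \<partial>H) * indicator (cball x r) z \<partial>H') \<partial>H)
      = (\<integral>\<^sup>+x. \<integral>\<^sup>+z. \<integral>\<^sup>+y. ?G x y z \<partial>H \<partial>H' \<partial>H)"
    by (simp add: nn_integral_cmult nn_integral_multc)
  \<comment> \<open>The variable \<open>x\<close> is moved inwards, first past \<open>z\<close> and
    then past \<open>y\<close>.\<close>
  also have "\<dots> = (\<integral>\<^sup>+z. \<integral>\<^sup>+x. \<integral>\<^sup>+y. ?G x y z \<partial>H \<partial>H \<partial>H')"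
    by (rule HH'.Fubini'[symmetric]) measurable
  also have "\<dots> = (\<integral>\<^sup>+z. \<integral>\<^sup>+y. \<integral>\<^sup>+x. ?G x y z \<partial>H \<partial>H \<partial>H')"
    by (intro nn_integral_cong HH.Fubini'[symmetric]) measurable
  also have "\<dots> \<le> (\<integral>\<^sup>+z. \<integral>\<^sup>+y. ennreal (Cd ^ 4 * K * r powr - t) * (indicator {(y,z). dist y z \<le> (1/2)^(Suc n)} (y,z) *
         weight M (Suc n) y z * ?e y z) \<partial>H \<partial>H')"
  proof (intro nn_integral_mono)
    fix y z
    show "(\<integral>\<^sup>+x. ?G x y z \<partial>H) \<le> ennreal (Cd ^ 4 * K * r powr - t) *
        (indicator {(y,z). dist y z \<le> (1/2)^(Suc n)} (y,z) * weight M (Suc n) y z * ?e y z)"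
    proof (cases "dist y z \<le> 2 * r")
      case True
      \<comment> \<open>The indicator at \<open>z\<close> is dropped; the one at \<open>y\<close>
        already confines \<open>x\<close> to a ball about \<open>y\<close>.\<close>
      have "(\<integral>\<^sup>+x. ?G x y z \<partial>H) \<le> (\<integral>\<^sup>+x. ?e y z * (ennreal (1 / (V r x)\<^sup>2) * indicator (cball x r) y) \<partial>H)"
        by (intro nn_integral_mono) (auto split: split_indicator simp: mult.commute)
      also have "\<dots> = ?e y z * (\<integral>\<^sup>+x. ennreal (1 / (V r x)\<^sup>2) * indicator (cball x r) y \<partial>H)"
        by (intro nn_integral_cmult) measurable
      also have "\<dots> \<le> ?e y z * ennreal (Cd\<^sup>2 * K * r powr - t * V r y / (V r y)\<^sup>2)"
        by (intro mult_left_mono kernel_integral_le[OF H] r0) auto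
      also have "Cd\<^sup>2 * K * r powr - t * V r y / (V r y)\<^sup>2 = Cd\<^sup>2 * K * r powr - t * (1 / V r y)"
        using V_pos[OF r0(1), of y] by (simp add: power2_eq_square)
      also have "ennreal (Cd\<^sup>2 * K * r powr - t * (1 / V r y)) = ennreal (Cd\<^sup>2 * K * r powr - t) * ennreal (1 / V r y)"
        using regularD(3)[OF H] by (intro ennreal_mult) auto
      also have "?e y z * (ennreal (Cd\<^sup>2 * K * r powr - t) * ennreal (1 / V r y)) \<le>
          ?e y z * (ennreal (Cd\<^sup>2 * K * r powr - t) * (ennreal (Cd\<^sup>2) * weight M (Suc n) y z))"
        using True r2 unfolding r by (intro mult_left_mono inverse_V_le_weight) auto
      also have "\<dots> = (ennreal (Cd\<^sup>2 * K * r powr - t) * ennreal (Cd\<^sup>2)) * (weight M (Suc n) y z * ?e y z)"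
        by (simp only: ac_simps)
      also have "ennreal (Cd\<^sup>2 * K * r powr - t) * ennreal (Cd\<^sup>2) = ennreal (Cd ^ 4 * K * r powr - t)"
        using regularD(3)[OF H] Cd_ge_1 by (subst ennreal_mult[symmetric]) (auto simp: power4_eq_xxxx power2_eq_square ac_simps)
      finally show ?thesis
        unfolding r2 using True by simp
    next
      case False
      have "indicator (cball x r) y * indicator (cball x r) z = (0::ennreal)" for x
        using False dist_triangle3[of y z x] by (auto split: split_indicator)
      then have zero: "?G x y z = 0" for x
        by (simp add: mult.assoc)
      show ?thesis
        unfolding zero by simp
    qed
  qed
  also have "\<dots> = ennreal (Cd ^ 4 * K * r powr - t) *
      (\<integral>\<^sup>+z. \<integral>\<^sup>+y. indicator {(y,z). dist y z \<le> (1/2)^(Suc n)} (y,z) *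
         weight M (Suc n) y z * ?e y z \<partial>H \<partial>H')"
    unfolding weight_def emeasure_cball
    by (subst nn_integral_cmult[symmetric], measurable) (intro nn_integral_cong nn_integral_cmult, measurable)
  finally show ?thesis .
qed

end

section \<open>Oscillations with respect to weighted sums of regular measures\<close>

locale regular_family = doubling_measure M Cd
  for M :: "'a::{metric_space,second_countable_topology} measure" and Cd :: real +
  fixes I :: "nat set" and H :: "nat \<Rightarrow> 'a measure" and t \<kappa> K :: "nat \<Rightarrow> real"
    and p \<theta> :: real and m :: "nat \<Rightarrow> 'a measure"
  assumes finite_I: "finite I"
    and regular_H: "i \<in> I \<Longrightarrow> regular (t i) (\<kappa> i) (K i) (H i)"
    and t_pos: "i \<in> I \<Longrightarrow> 0 < t i"
    and p_ge_1: "1 \<le> p" and \<theta>_le_p: "\<theta> \<le> p"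
    and m_eq: "m n = measure_of UNIV (sets borel)
      (\<lambda>E. \<Sum>i\<in>I. ennreal (2 powr (real n * (\<theta> - t i))) * emeasure (H i) E)"
begin

definition a :: "nat \<Rightarrow> nat \<Rightarrow> real" where
  "a n i = 2 powr (real n * (\<theta> - t i))"

text \<open>This is the double integral at level \<open>n\<close> in the gluing functional for the
  pair \<open>i\<close>, \<open>j\<close>, with \<open>H i\<close> and \<open>H j\<close> as the two
  measures.\<close>

definition G :: "nat \<Rightarrow> nat \<Rightarrow> nat \<Rightarrow> ('a \<Rightarrow> real) \<Rightarrow> ennreal" where
  "G n i j f = (\<integral>\<^sup>+z. \<integral>\<^sup>+y. indicator {(y,z). dist y z \<le> (1/2)^n} (y,z) *
     weight M n y z * epow (ennreal \<bar>f y - f z\<bar>) p \<partial>H i \<partial>H j)"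

lemma a_pos [simp]: "0 < a n i" "0 \<le> a n i" "a n i \<noteq> 0"
  by (simp_all add: a_def)

lemmas sets_H = regularD(1)[OF regular_H]

lemma sets_m: "sets (m n) = sets borel"
  using sets_H finite_I m_eq by (rule sets_measure_of_sum)

lemma emeasure_m: "E \<in> sets borel \<Longrightarrow> emeasure (m n) E = (\<Sum>i\<in>I. ennreal (a n i) * emeasure (H i) E)"
  unfolding a_def using sets_H finite_I m_eq by (rule emeasure_measure_of_sum)

lemma nn_integral_m_le: "(\<integral>\<^sup>+x. g x \<partial>m n) \<le> (\<Sum>i\<in>I. ennreal (a n i) * (\<integral>\<^sup>+x. g x \<partial>H i))"
  unfolding a_def using sets_H finite_I m_eq by (rule nn_integral_measure_of_sum_le)

text \<open>The masses of a ball are collected as real numbers, so that quotients can be estimated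
  in the reals. The statement is almost everywhere because the lower regularity bound is; the last
  inequality holds since \<open>m n\<close> dominates each weighted summand.\<close>

lemma AE_cball:
  assumes i: "i \<in> I" and r: "0 < r" "r \<le> 1/2"
  shows "AE x in H i. \<exists>h D. emeasure (H i) (cball x r) = ennreal h \<and> emeasure (m n) (cball x r) = ennreal D
    \<and> \<kappa> i * V r x * r powr - t i \<le> h \<and> 0 < h \<and> a n i * h \<le> D"
  using regularD(4)[OF regular_H[OF i]]
proof eventually_elim
  case (elim x)
  have fin: "emeasure (H j) (cball x r) < \<infinity>" if "j \<in> I" for j
    using regularD(5)[OF regular_H[OF that] r, of x] by (simp add: le_less_trans)
  then obtain h where h: "emeasure (H i) (cball x r) = ennreal h" "0 \<le> h"
    using fin[OF i] by (cases "emeasure (H i) (cball x r)") auto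
  have "emeasure (m n) (cball x r) < \<infinity>"
    using fin by (auto simp: emeasure_m finite_I less_top[symmetric] ennreal_mult_eq_top_iff)
  then obtain D where D: "emeasure (m n) (cball x r) = ennreal D" "0 \<le> D"
    by (cases "emeasure (m n) (cball x r)") auto
  have pos: "0 < \<kappa> i * V r x * r powr - t i"
    using r regularD(2)[OF regular_H[OF i]] V_pos[of r x] by simp
  have "ennreal (\<kappa> i * V r x * r powr - t i) \<le> ennreal h"
    using bspec[OF elim, of r] r unfolding h(1) by simp
  then have le: "\<kappa> i * V r x * r powr - t i \<le> h"
    using h by simp
  have "ennreal (a n i) * emeasure (H i) (cball x r) \<le> emeasure (m n) (cball x r)"
    unfolding emeasure_m[OF borel_closed[OF closed_cball]] using i finite_I by (intro member_le_sum) auto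
  then have "a n i * h \<le> D"
    using h D by (simp add: ennreal_mult[symmetric])
  then show ?case
    using h D pos le by (intro exI[of _ h] exI[of _ D]) auto
qed

text \<open>The oscillation is at most the average of \<open>\<bar>f\<bar>\<close>, and integrating
  over the centre first returns the \<open>L_p\<close> integrals. The factor \<open>4 powr p\<close>
  combines the constant of \<open>epow_integral_le\<close> with the bound \<open>2 powr p\<close>
  for the weights \<open>a 1 j\<close>; the weight \<open>a 1 i\<close> cancels.\<close>

lemma level_1_le:
  assumes i: "i \<in> I" and f [measurable]: "f \<in> borel_measurable borel"
  shows "ennreal (2 powr (\<theta> - p)) * (ennreal (a 1 i) * (\<integral>\<^sup>+x. epow (Eosc (m 1) f (cball x (1/2))) p \<partial>H i))
    \<le> ennreal (4 powr p * Cd * K i / \<kappa> i) * (\<Sum>j\<in>I. \<integral>\<^sup>+x. epow (ennreal \<bar>f x\<bar>) p \<partial>H j)"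
proof -
  note Hi = regular_H[OF i]
  \<comment> \<open>Lower regularity of \<open>H i\<close> makes \<open>c / V (1/2) x\<close> an
    upper bound for \<open>2 powr p\<close> divided by the \<open>m 1\<close> mass of the
    ball.\<close>
  define c where "c = 2 powr p * (1 / (a 1 i * \<kappa> i * (1/2) powr - t i))"
  have \<kappa>: "0 < \<kappa> i" "0 < K i"
    using regularD(2,3)[OF Hi] by auto
  have c: "0 \<le> c"
    using \<kappa> by (simp add: c_def)
  interpret Hi: sigma_finite_measure "H i" by (rule regular_sigma_finite[OF Hi])
  note [measurable_cong] = sets_H[OF i] sets_m
  let ?e = "\<lambda>z. epow (ennreal \<bar>f z\<bar>) p"
  have shuffle: "ennreal u * (ennreal (v * w) * (ennreal q * Y)) = ennreal (u * v * q) * (ennreal w * Y)"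
    if "0 \<le> u" "0 \<le> v" "0 \<le> w" "0 \<le> q" for u v w q Y
    using that by (simp add: ennreal_mult ac_simps)
  have "AE x in H i. epow (Eosc (m 1) f (cball x (1/2))) p
    \<le> (\<Sum>j\<in>I. ennreal (c * a 1 j) * (ennreal (1 / V (1/2) x) * (\<integral>\<^sup>+z. ?e z * indicator (cball x (1/2)) z \<partial>H j)))"
    using AE_cball[OF i, of "1/2" 1, simplified]
  proof eventually_elim
    case (elim x)
    let ?B = "cball x (1/2)"
    obtain h D where h: "emeasure (H i) ?B = ennreal h" "0 < h" "\<kappa> i * V (1/2) x * (1/2) powr - t i \<le> h"
      and D: "emeasure (m 1) ?B = ennreal D" "a 1 i * h \<le> D"
      using elim by auto
    have V: "0 < V (1/2) x"
      by (intro V_pos) simp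
    have D_pos: "0 < D"
      using mult_pos_pos[OF a_pos(1)[of 1 i] h(2)] D(2) by linarith
    have "a 1 i * (\<kappa> i * V (1/2) x * (1/2) powr - t i) \<le> D"
      by (rule order_trans[OF mult_left_mono[OF h(3)] D(2)]) simp
    then have D_inv: "1 / D \<le> 1 / (a 1 i * \<kappa> i * (1/2) powr - t i) * (1 / V (1/2) x)"
      using V \<kappa> D_pos by (simp add: field_simps)
    have mass: "ennreal (1 / D) * emeasure (m 1) ?B \<le> 1"
      using D D_pos by (simp flip: ennreal_mult)
    have "Eosc (m 1) f ?B \<le> Av (m 1) ?B (\<lambda>y. ennreal \<bar>f y - 0\<bar>)"
      unfolding Eosc_def by (rule INF_lower) simp
    also have "\<dots> = ennreal (1 / D) * (\<integral>\<^sup>+z. ennreal \<bar>f z\<bar> * indicator ?B z \<partial>m 1)"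
      using D D_pos by (simp add: Av_def divide_ennreal_def inverse_ennreal inverse_eq_divide mult.commute)
    finally have "epow (Eosc (m 1) f ?B) p
        \<le> epow (ennreal (1 / D) * (\<integral>\<^sup>+z. ennreal \<bar>f z\<bar> * indicator ?B z \<partial>m 1)) p"
      using p_ge_1 by (intro epow_mono) auto
    also have "\<dots> \<le> ennreal (2 powr p) * (ennreal (1 / D) * (\<integral>\<^sup>+z. ?e z * indicator ?B z \<partial>m 1))"
      using p_ge_1 mass by (intro epow_integral_le) (auto simp: sets_m)
    also have "\<dots> \<le> ennreal (2 powr p) * (ennreal (1 / (a 1 i * \<kappa> i * (1/2) powr - t i) * (1 / V (1/2) x)) *
        (\<Sum>j\<in>I. ennreal (a 1 j) * (\<integral>\<^sup>+z. ?e z * indicator ?B z \<partial>H j)))"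
      by (intro mult_left_mono mult_mono ennreal_leI D_inv nn_integral_m_le) auto
    also have "\<dots> = (\<Sum>j\<in>I. ennreal (c * a 1 j) * (ennreal (1 / V (1/2) x) * (\<integral>\<^sup>+z. ?e z * indicator ?B z \<partial>H j)))"
      unfolding sum_distrib_left c_def using \<kappa> V by (intro sum.cong refl shuffle) auto
    finally show ?case .
  qed
  then have "(\<integral>\<^sup>+x. epow (Eosc (m 1) f (cball x (1/2))) p \<partial>H i) \<le>
      (\<integral>\<^sup>+x. (\<Sum>j\<in>I. ennreal (c * a 1 j) * (ennreal (1 / V (1/2) x) * (\<integral>\<^sup>+z. ?e z * indicator (cball x (1/2)) z \<partial>H j))) \<partial>H i)"
    by (rule nn_integral_mono_AE)
  also have "\<dots> = (\<Sum>j\<in>I. ennreal (c * a 1 j) * (\<integral>\<^sup>+x. ennreal (1 / V (1/2) x) * (\<integral>\<^sup>+z. ?e z * indicator (cball x (1/2)) z \<partial>H j) \<partial>H i))"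
  proof -
    have [measurable]: "(\<lambda>x. \<integral>\<^sup>+z. ?e z * indicator (cball x (1/2)) z \<partial>H j) \<in> borel_measurable borel" if "j \<in> I" for j
    proof -
      interpret Hj: sigma_finite_measure "H j" by (rule regular_sigma_finite[OF regular_H[OF that]])
      note [measurable_cong] = sets_H[OF that]
      show ?thesis by measurable
    qed
    show ?thesis
      by (subst nn_integral_sum) (auto intro!: sum.cong nn_integral_cmult)
  qed
  also have "\<dots> \<le> (\<Sum>j\<in>I. ennreal (c * 2 powr p) * (ennreal (Cd * K i * (1/2) powr - t i) * (\<integral>\<^sup>+z. ?e z \<partial>H j)))"
  proof (intro sum_mono mult_mono ennreal_leI)
    fix j assume j: "j \<in> I"
    show "a 1 j \<le> 2 powr p"
      using t_pos[OF j] \<theta>_le_p by (simp add: a_def)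
    interpret Hj: sigma_finite_measure "H j" by (rule regular_sigma_finite[OF regular_H[OF j]])
    interpret pair_sigma_finite "H i" "H j" ..
    note [measurable_cong] = sets_H[OF j]
    have "(\<integral>\<^sup>+x. ennreal (1 / V (1/2) x) * (\<integral>\<^sup>+z. ?e z * indicator (cball x (1/2)) z \<partial>H j) \<partial>H i)
        = (\<integral>\<^sup>+x. \<integral>\<^sup>+z. ?e z * (ennreal (1 / V (1/2) x ^ 1) * indicator (cball x (1/2)) z) \<partial>H j \<partial>H i)"
      by (subst nn_integral_cmult[symmetric]) (auto simp: ac_simps)
    also have "\<dots> = (\<integral>\<^sup>+z. \<integral>\<^sup>+x. ?e z * (ennreal (1 / V (1/2) x ^ 1) * indicator (cball x (1/2)) z) \<partial>H i \<partial>H j)"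
      by (rule Fubini'[symmetric]) measurable
    also have "\<dots> = (\<integral>\<^sup>+z. ?e z * (\<integral>\<^sup>+x. ennreal (1 / V (1/2) x ^ 1) * indicator (cball x (1/2)) z \<partial>H i) \<partial>H j)"
      by (intro nn_integral_cong nn_integral_cmult) measurable
    \<comment> \<open>With exponent 1 the two volume factors at \<open>z\<close> cancel, leaving a
      constant multiple of the \<open>L_p\<close> integral.\<close>
    also have "\<dots> \<le> (\<integral>\<^sup>+z. ?e z * ennreal (Cd ^ 1 * K i * (1/2) powr - t i * V (1/2) z / V (1/2) z ^ 1) \<partial>H j)"
      by (intro nn_integral_mono mult_left_mono kernel_integral_le[OF Hi]) auto
    also have "\<dots> = (\<integral>\<^sup>+z. ennreal (Cd * K i * (1/2) powr - t i) * ?e z \<partial>H j)"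
      using V_pos[of "1/2"] by (intro nn_integral_cong) (simp add: mult.commute less_imp_neq[symmetric])
    also have "\<dots> = ennreal (Cd * K i * (1/2) powr - t i) * (\<integral>\<^sup>+z. ?e z \<partial>H j)"
      by (intro nn_integral_cmult) measurable
    finally show "(\<integral>\<^sup>+x. ennreal (1 / V (1/2) x) * (\<integral>\<^sup>+z. ?e z * indicator (cball x (1/2)) z \<partial>H j) \<partial>H i)
      \<le> ennreal (Cd * K i * (1/2) powr - t i) * (\<integral>\<^sup>+z. ?e z \<partial>H j)" .
  qed (use c in auto)
  also have "\<dots> = ennreal (c * 2 powr p * (Cd * K i * (1/2) powr - t i)) * (\<Sum>j\<in>I. \<integral>\<^sup>+x. ?e x \<partial>H j)"
    using c \<kappa> Cd_ge_1 by (simp add: sum_distrib_left mult.assoc ennreal_mult)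
  finally have "ennreal (2 powr (\<theta> - p)) * (ennreal (a 1 i) * (\<integral>\<^sup>+x. epow (Eosc (m 1) f (cball x (1/2))) p \<partial>H i))
      \<le> ennreal 1 * (ennreal (a 1 i) * (ennreal (c * 2 powr p * (Cd * K i * (1/2) powr - t i)) * (\<Sum>j\<in>I. \<integral>\<^sup>+x. ?e x \<partial>H j)))"
    using \<theta>_le_p powr_mono[of "\<theta> - p" 0 2] by (intro mult_mono ennreal_leI) auto
  also have "\<dots> = ennreal (a 1 i * (c * 2 powr p * (Cd * K i * (1/2) powr - t i))) * (\<Sum>j\<in>I. \<integral>\<^sup>+x. ?e x \<partial>H j)"
    using c \<kappa> Cd_ge_1 by (simp add: mult.assoc ennreal_mult)
  also have "a 1 i * (c * 2 powr p * (Cd * K i * (1/2) powr - t i)) = 2 powr p * 2 powr p * Cd * K i / \<kappa> i"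
    using a_pos(1)[of 1 i] \<kappa> unfolding c_def by (simp add: field_simps)
  also have "2 powr p * 2 powr p = (4::real) powr p"
    by (simp flip: powr_mult)
  finally show ?thesis .
qed

text \<open>The pointwise bound of \<open>Eosc_sum_le\<close> is raised to the power
  \<open>p\<close> and integrated over the centre. Level \<open>k = n + 2\<close> on the left meets
  gluing level \<open>n + 1\<close>. In the constant, \<open>8 powr p\<close> consists of
  \<open>4 powr p\<close> from two uses of \<open>epow_integral_le\<close> and
  \<open>2 powr p\<close> from this shift of level.\<close>

lemma level_ge_2_le:
  fixes n :: nat
  defines "k \<equiv> Suc (Suc n)"
  assumes i: "i \<in> I" and f [measurable]: "f \<in> borel_measurable borel"
  shows "ennreal (2 powr (real k * (\<theta> - p))) * (ennreal (a k i) * (\<integral>\<^sup>+x. epow (Eosc (m k) f (cball x ((1/2)^k))) p \<partial>H i))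
    \<le> ennreal ((2 * card I) powr p * (1 + 8 powr p * Cd ^ 4 * K i / (\<kappa> i)\<^sup>2)) *
      (ennreal (2 powr (real k * (p - t i))) * (\<integral>\<^sup>+x. epow (Eosc (H i) f (cball x ((1/2)^k))) p \<partial>H i)
        + (\<Sum>j\<in>I - {i}. ennreal (2 powr (real (Suc n) * (p - t i - t j))) * G (Suc n) i j f))"
proof -
  note Hi = regular_H[OF i]
  have \<kappa>: "0 < \<kappa> i" "0 < K i"
    using regularD(2,3)[OF Hi] by auto
  define r :: real where "r = (1/2) ^ k"
  have r: "0 < r" "r \<le> 1/2"
    using power_le_one[of "1/2::real" n] by (auto simp: r_def k_def)
  have r_powr: "r powr - s = 2 powr (real k * s)" for s
    by (simp add: r_def powr_realpow[symmetric] powr_powr powr_minus powr_divide)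
  interpret Hi: sigma_finite_measure "H i" by (rule regular_sigma_finite[OF Hi])
  note [measurable_cong] = sets_H[OF i] sets_m
  define N where "N = real (card I)"
  \<comment> \<open>Divided by the square of \<open>V r x\<close>, this bounds
    \<open>4 powr p * (a k j / (D * h))\<close>, where \<open>D\<close> and \<open>h\<close> are the
    masses of the ball under \<open>m k\<close> and \<open>H i\<close>. The parameter \<theta>
    cancels in the quotient of \<open>a k j\<close> and \<open>a k i\<close>.\<close>
  define b where "b j = 4 powr p / (\<kappa> i)\<^sup>2 * 2 powr - (real k * (t i + t j))" for j
  have b: "0 \<le> b j" for j
    by (simp add: b_def)
  \<comment> \<open>This is the integrand that \<open>gluing_integral_le\<close> estimates after
    integration over \<open>x\<close>.\<close>
  define Q where "Q j x = ennreal (1 / (V r x)\<^sup>2) * (\<integral>\<^sup>+z. (\<integral>\<^sup>+y. epow (ennreal \<bar>f y - f z\<bar>) p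
        * indicator (cball x r) y \<partial>H i) * indicator (cball x r) z \<partial>H j)" for j x
  have Q_meas [measurable]: "Q j \<in> borel_measurable borel" if "j \<in> I" for j
  proof -
    interpret Hj: sigma_finite_measure "H j" by (rule regular_sigma_finite[OF regular_H[OF that]])
    note [measurable_cong] = sets_H[OF that]
    show ?thesis unfolding Q_def by measurable
  qed
  have E_meas [measurable]: "(\<lambda>x. Eosc (H i) f (cball x r)) \<in> borel_measurable borel"
    using sets_H[OF i] Hi.sigma_finite_measure_axioms f by (rule borel_measurable_Eosc)
  have "AE x in H i. epow (Eosc (m k) f (cball x r)) p \<le> ennreal ((2 * N) powr p) *
      (epow (Eosc (H i) f (cball x r)) p + (\<Sum>j\<in>I - {i}. ennreal (b j) * Q j x))"
    using AE_cball[OF i r, of k]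
  proof eventually_elim
    case (elim x)
    let ?B = "cball x r"
    obtain h D where h: "emeasure (H i) ?B = ennreal h" "0 < h" "\<kappa> i * V r x * r powr - t i \<le> h"
      and D: "emeasure (m k) ?B = ennreal D" "a k i * h \<le> D"
      using elim by auto
    have V: "0 < V r x"
      using r by (intro V_pos)
    have D_pos: "0 < D"
      using mult_pos_pos[OF a_pos(1)[of k i] h(2)] D(2) by linarith
    define T where "T j = ennreal (a k j / D) * (\<integral>\<^sup>+z. ennreal (1 / h) *
       (\<integral>\<^sup>+y. ennreal \<bar>f y - f z\<bar> * indicator ?B y \<partial>H i) * indicator ?B z \<partial>H j)" for j
    have T: "epow (T j) p \<le> ennreal (b j) * Q j x" if j: "j \<in> I" for j
    proof -
      interpret Hj: sigma_finite_measure "H j" by (rule regular_sigma_finite[OF regular_H[OF j]])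
      note [measurable_cong] = sets_H[OF j]
      have "ennreal (a k j) * emeasure (H j) ?B \<le> ennreal D"
        unfolding D(1)[symmetric] emeasure_m[OF borel_closed[OF closed_cball]]
        using finite_I j by (intro member_le_sum) auto
      then have "ennreal (1 / D) * (ennreal (a k j) * emeasure (H j) ?B) \<le> ennreal (1 / D) * ennreal D"
        by (intro mult_left_mono) auto
      also have "\<dots> = 1"
        using D_pos by (simp flip: ennreal_mult)
      also have "ennreal (1 / D) * (ennreal (a k j) * emeasure (H j) ?B) = ennreal (a k j / D) * emeasure (H j) ?B"
        using D_pos by (simp add: mult.assoc[symmetric] ennreal_mult[symmetric])
      finally have mass: "ennreal (a k j / D) * emeasure (H j) ?B \<le> 1" .
      have mass_i: "ennreal (1 / h) * emeasure (H i) ?B \<le> 1"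
        using h by (simp flip: ennreal_mult)
      \<comment> \<open>The power is taken inside the average over \<open>z\<close> first, then
        inside the average over \<open>y\<close>.\<close>
      have "epow (T j) p \<le> ennreal (2 powr p) * (ennreal (a k j / D) * (\<integral>\<^sup>+z. epow (ennreal (1 / h) *
          (\<integral>\<^sup>+y. ennreal \<bar>f y - f z\<bar> * indicator ?B y \<partial>H i)) p * indicator ?B z \<partial>H j))"
        unfolding T_def using p_ge_1 mass by (intro epow_integral_le) (auto simp: sets_H[OF j])
      also have "\<dots> \<le> ennreal (2 powr p) * (ennreal (a k j / D) * (\<integral>\<^sup>+z. (ennreal (2 powr p) * (ennreal (1 / h) *
          (\<integral>\<^sup>+y. epow (ennreal \<bar>f y - f z\<bar>) p * indicator ?B y \<partial>H i))) * indicator ?B z \<partial>H j))"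
        using p_ge_1 mass_i
        by (intro mult_left_mono nn_integral_mono mult_right_mono epow_integral_le) (auto simp: sets_H[OF i])
      also have "\<dots> = ennreal (2 powr p) * (ennreal (a k j / D) * (ennreal (2 powr p) * (ennreal (1 / h) * (\<integral>\<^sup>+z.
          (\<integral>\<^sup>+y. epow (ennreal \<bar>f y - f z\<bar>) p * indicator ?B y \<partial>H i) * indicator ?B z \<partial>H j))))"
        by (simp add: nn_integral_cmult mult.assoc)
      also have "\<dots> = ennreal (4 powr p * (a k j / (D * h))) * (\<integral>\<^sup>+z.
          (\<integral>\<^sup>+y. epow (ennreal \<bar>f y - f z\<bar>) p * indicator ?B y \<partial>H i) * indicator ?B z \<partial>H j)"
      proof -
        have shuffle: "ennreal u * (ennreal v * (ennreal u * (ennreal w * Y))) = ennreal (u * u * (v * w)) * Y"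
          if "0 \<le> u" "0 \<le> v" "0 \<le> w" for u v w Y
          using that by (simp add: ennreal_mult ac_simps)
        have "4 powr p * (a k j / (D * h)) = (2 powr p * 2 powr p) * (a k j / D * (1 / h))"
          by (simp flip: powr_mult)
        then show ?thesis
          using D_pos h(2) by (simp only:) (rule shuffle, auto)
      qed
      also have "\<dots> \<le> ennreal (b j * (1 / (V r x)\<^sup>2)) * (\<integral>\<^sup>+z.
          (\<integral>\<^sup>+y. epow (ennreal \<bar>f y - f z\<bar>) p * indicator ?B y \<partial>H i) * indicator ?B z \<partial>H j)"
      proof (intro mult_right_mono ennreal_leI)
        have "(\<kappa> i * V r x * r powr - t i)\<^sup>2 \<le> h\<^sup>2"
          using h(3) \<kappa> by (intro power_mono) auto
        then have "a k i * (\<kappa> i * V r x * r powr - t i)\<^sup>2 \<le> a k i * h\<^sup>2"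
          by (intro mult_left_mono) auto
        also have "\<dots> \<le> D * h"
          using mult_right_mono[OF D(2), of h] h(2) by (simp add: power2_eq_square ac_simps)
        finally have "a k j / (D * h) \<le> a k j / (a k i * (\<kappa> i * V r x * r powr - t i)\<^sup>2)"
          using \<kappa> V r a_pos(1)[of k i] D_pos h(2) by (intro divide_left_mono mult_pos_pos) auto
        also have "\<dots> = (a k j / (a k i * (r powr - t i)\<^sup>2)) * (1 / (\<kappa> i)\<^sup>2) * (1 / (V r x)\<^sup>2)"
          by (simp add: power_mult_distrib ac_simps)
        also have "a k j / (a k i * (r powr - t i)\<^sup>2) = 2 powr - (real k * (t i + t j))"
          unfolding r_powr a_def power2_eq_square
          by (simp add: algebra_simps flip: powr_diff powr_add)
        finally have "4 powr p * (a k j / (D * h)) \<le> 4 powr p *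
            (2 powr - (real k * (t i + t j)) * (1 / (\<kappa> i)\<^sup>2) * (1 / (V r x)\<^sup>2))"
          by (intro mult_left_mono) auto
        then show "4 powr p * (a k j / (D * h)) \<le> b j * (1 / (V r x)\<^sup>2)"
          by (simp add: b_def)
      qed auto
      also have "\<dots> = ennreal (b j) * Q j x"
        by (subst ennreal_mult) (auto simp: b Q_def mult.assoc)
      finally show ?thesis .
    qed
    have "Eosc (m k) f ?B \<le> of_nat (card I) * Eosc (H i) f ?B + (\<Sum>j\<in>I - {i}. T j)"
      unfolding T_def
      by (rule Eosc_sum_le[OF finite_I i sets_H sets_m emeasure_m nn_integral_m_le a_pos(1) _ f D(1) D_pos h(1,2)])
        (use regular_sigma_finite[OF regular_H] in auto)
    then have "epow (Eosc (m k) f ?B) p \<le> epow (ennreal N * Eosc (H i) f ?B + (\<Sum>j\<in>I - {i}. T j)) p"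
      using p_ge_1 by (intro epow_mono) (auto simp: N_def ennreal_of_nat_eq_real_of_nat)
    also have "\<dots> \<le> ennreal (2 powr p) * (epow (ennreal N * Eosc (H i) f ?B) p + epow (\<Sum>j\<in>I - {i}. T j) p)"
      using p_ge_1 by (intro epow_add_le) auto
    also have "\<dots> \<le> ennreal (2 powr p) * (ennreal (N powr p) * epow (Eosc (H i) f ?B) p
        + ennreal (N powr p) * (\<Sum>j\<in>I - {i}. ennreal (b j) * Q j x))"
    proof (intro mult_left_mono add_mono)
      show "epow (ennreal N * Eosc (H i) f ?B) p \<le> ennreal (N powr p) * epow (Eosc (H i) f ?B) p"
        by (simp add: epow_mult epow_ennreal N_def)
      have "epow (\<Sum>j\<in>I - {i}. T j) p \<le> ennreal (real (card (I - {i})) powr p) * (\<Sum>j\<in>I - {i}. epow (T j) p)"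
        using finite_I p_ge_1 by (intro epow_sum_le) auto
      also have "\<dots> \<le> ennreal (N powr p) * (\<Sum>j\<in>I - {i}. ennreal (b j) * Q j x)"
        using T p_ge_1 finite_I unfolding N_def
        by (intro mult_mono sum_mono ennreal_leI powr_mono2) (auto intro!: card_mono)
      finally show "epow (\<Sum>j\<in>I - {i}. T j) p \<le> ennreal (N powr p) * (\<Sum>j\<in>I - {i}. ennreal (b j) * Q j x)" .
    qed auto
    also have "\<dots> = ennreal ((2 * N) powr p) * (epow (Eosc (H i) f ?B) p + (\<Sum>j\<in>I - {i}. ennreal (b j) * Q j x))"
      by (simp add: powr_mult N_def ennreal_mult distrib_left mult.assoc)
    finally show ?case .
  qed
  then have "(\<integral>\<^sup>+x. epow (Eosc (m k) f (cball x r)) p \<partial>H i) \<le> (\<integral>\<^sup>+x. ennreal ((2 * N) powr p) *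
      (epow (Eosc (H i) f (cball x r)) p + (\<Sum>j\<in>I - {i}. ennreal (b j) * Q j x)) \<partial>H i)"
    by (rule nn_integral_mono_AE)
  also have "\<dots> = ennreal ((2 * N) powr p) * ((\<integral>\<^sup>+x. epow (Eosc (H i) f (cball x r)) p \<partial>H i)
      + (\<Sum>j\<in>I - {i}. ennreal (b j) * (\<integral>\<^sup>+x. Q j x \<partial>H i)))"
  proof -
    have "(\<integral>\<^sup>+x. (\<Sum>j\<in>I - {i}. ennreal (b j) * Q j x) \<partial>H i) = (\<Sum>j\<in>I - {i}. ennreal (b j) * (\<integral>\<^sup>+x. Q j x \<partial>H i))"
      by (subst nn_integral_sum) (auto intro!: sum.cong nn_integral_cmult)
    then show ?thesis
      by (simp add: nn_integral_cmult nn_integral_add)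
  qed
  also have "\<dots> \<le> ennreal ((2 * N) powr p) * ((\<integral>\<^sup>+x. epow (Eosc (H i) f (cball x r)) p \<partial>H i)
      + (\<Sum>j\<in>I - {i}. ennreal (b j) * (ennreal (Cd ^ 4 * K i * r powr - t i) * G (Suc n) i j f)))"
    unfolding Q_def G_def
    by (intro mult_left_mono add_left_mono sum_mono gluing_integral_le[OF Hi regular_H f])
      (auto simp: r_def k_def)
  finally have *: "(\<integral>\<^sup>+x. epow (Eosc (m k) f (cball x r)) p \<partial>H i) \<le> \<dots>" .
  \<comment> \<open>The summand 1 makes a single constant serve both the Besov term and the gluing
    terms.\<close>
  define L where "L = 1 + 8 powr p * Cd ^ 4 * K i / (\<kappa> i)\<^sup>2"
  have L1: "1 \<le> L" "8 powr p * Cd ^ 4 * K i / (\<kappa> i)\<^sup>2 \<le> L"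
    using \<kappa> Cd_ge_1 by (auto simp: L_def)
  define W where "W = 2 powr (real k * (\<theta> - p)) * a k i"
  have W: "0 \<le> W"
    by (simp add: W_def)
  have "ennreal (2 powr (real k * (\<theta> - p))) * (ennreal (a k i) * (\<integral>\<^sup>+x. epow (Eosc (m k) f (cball x r)) p \<partial>H i))
      = ennreal W * (\<integral>\<^sup>+x. epow (Eosc (m k) f (cball x r)) p \<partial>H i)"
    by (simp add: W_def ennreal_mult mult.assoc)
  also have "\<dots> \<le> ennreal W * (ennreal ((2 * N) powr p) * ((\<integral>\<^sup>+x. epow (Eosc (H i) f (cball x r)) p \<partial>H i)
      + (\<Sum>j\<in>I - {i}. ennreal (b j) * (ennreal (Cd ^ 4 * K i * r powr - t i) * G (Suc n) i j f))))"
    by (rule mult_left_mono[OF *]) simp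
  also have "\<dots> = ennreal ((2 * N) powr p) * (ennreal W * (\<integral>\<^sup>+x. epow (Eosc (H i) f (cball x r)) p \<partial>H i)
      + (\<Sum>j\<in>I - {i}. ennreal (W * b j * (Cd ^ 4 * K i * r powr - t i)) * G (Suc n) i j f))"
    using W b \<kappa> Cd_ge_1
    by (simp add: distrib_left sum_distrib_left ennreal_mult ac_simps)
  also have "\<dots> \<le> ennreal ((2 * N) powr p) * (ennreal (L * 2 powr (real k * (p - t i))) * (\<integral>\<^sup>+x. epow (Eosc (H i) f (cball x r)) p \<partial>H i)
      + (\<Sum>j\<in>I - {i}. ennreal (L * 2 powr (real (Suc n) * (p - t i - t j))) * G (Suc n) i j f))"
  proof (intro mult_left_mono add_mono mult_right_mono sum_mono ennreal_leI)
    \<comment> \<open>Replacing \<theta> by \<open>p\<close> in the exponent leaves exactly the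
      Besov weight of smoothness \<open>1 - t i / p\<close>.\<close>
    have W_le: "W \<le> 2 powr (real k * (p - t i))"
    proof -
      have "real k * (\<theta> - p) + real k * (\<theta> - t i) \<le> real k * (p - t i)"
        unfolding distrib_left[symmetric] using \<theta>_le_p by (intro mult_left_mono) auto
      then show ?thesis
        by (simp add: W_def a_def flip: powr_add)
    qed
    then show "W \<le> L * 2 powr (real k * (p - t i))"
      using mult_right_mono[OF L1(1) powr_ge_zero, of 2 "real k * (p - t i)"] by linarith
    fix j assume j: "j \<in> I - {i}"
    \<comment> \<open>The left side is \<open>k * (p - t i - t j)\<close>. Passing from level
      \<open>k\<close> to \<open>k - 1\<close> costs \<open>p - t i - t j\<close>, which is at most
      \<open>p\<close> because both dimensions are positive.\<close>
    have exps: "real k * (p - t i) + - (real k * (t i + t j)) + real k * t i \<le> p + real (Suc n) * (p - t i - t j)"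
      using t_pos[OF i] t_pos[of j] j by (simp add: k_def algebra_simps)
    have "W * b j * (Cd ^ 4 * K i * r powr - t i)
        \<le> 2 powr (real k * (p - t i)) * b j * (Cd ^ 4 * K i * r powr - t i)"
      using W_le b \<kappa> by (intro mult_right_mono) auto
    also have "\<dots> = 4 powr p * Cd ^ 4 * K i / (\<kappa> i)\<^sup>2 *
        2 powr (real k * (p - t i) + - (real k * (t i + t j)) + real k * t i)"
      unfolding b_def r_powr powr_add by simp
    also have "\<dots> \<le> 4 powr p * Cd ^ 4 * K i / (\<kappa> i)\<^sup>2 * 2 powr (p + real (Suc n) * (p - t i - t j))"
      using exps \<kappa> by (intro mult_left_mono powr_mono) auto
    also have "\<dots> = (4 powr p * 2 powr p) * Cd ^ 4 * K i / (\<kappa> i)\<^sup>2 * 2 powr (real (Suc n) * (p - t i - t j))"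
      by (simp add: powr_add)
    also have "4 powr p * 2 powr p = (8::real) powr p"
      by (simp flip: powr_mult)
    also have "8 powr p * Cd ^ 4 * K i / (\<kappa> i)\<^sup>2 * 2 powr (real (Suc n) * (p - t i - t j))
        \<le> L * 2 powr (real (Suc n) * (p - t i - t j))"
      using L1 by (intro mult_right_mono) auto
    finally show "W * b j * (Cd ^ 4 * K i * r powr - t i) \<le> L * 2 powr (real (Suc n) * (p - t i - t j))" .
  qed auto
  finally show ?thesis
    unfolding r_def[symmetric] L_def[symmetric] using L1(1)
    by (simp add: N_def ennreal_mult sum_distrib_left distrib_left mult.assoc)
qed

end

context regular_family
begin

text \<open>Finite sums and series are interchanged, the first level goes to the \<open>L_p\<close>
  integrals, and the remaining levels are summed termwise.\<close>

lemma level_sum_le: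
  assumes f: "f \<in> borel_measurable borel"
  shows "(\<Sum>k. ennreal (2 powr (real (Suc k) * (\<theta> - p))) *
      (\<integral>\<^sup>+x. epow (Eosc (m (Suc k)) f (cball x ((1/2)^(Suc k)))) p \<partial>m (Suc k)))
    \<le> (\<Sum>i\<in>I. ennreal (4 powr p * Cd * K i / \<kappa> i) * (\<Sum>j\<in>I. \<integral>\<^sup>+x. epow (ennreal \<bar>f x\<bar>) p \<partial>H j)
        + ennreal ((2 * card I) powr p * (1 + 8 powr p * Cd ^ 4 * K i / (\<kappa> i)\<^sup>2)) *
          ((\<Sum>k. ennreal (2 powr (real (Suc k) * (p - t i))) * (\<integral>\<^sup>+x. epow (Eosc (H i) f (cball x ((1/2)^(Suc k)))) p \<partial>H i))
            + (\<Sum>j\<in>I - {i}. \<Sum>k. ennreal (2 powr (real (Suc k) * (p - t i - t j))) * G (Suc k) i j f)))"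
proof -
  define \<tau> where "\<tau> i k = ennreal (2 powr (real (Suc k) * (\<theta> - p))) * (ennreal (a (Suc k) i) *
      (\<integral>\<^sup>+x. epow (Eosc (m (Suc k)) f (cball x ((1/2)^(Suc k)))) p \<partial>H i))" for i k
  define e where "e i k = ennreal (2 powr (real (Suc k) * (p - t i))) *
      (\<integral>\<^sup>+x. epow (Eosc (H i) f (cball x ((1/2)^(Suc k)))) p \<partial>H i)" for i k
  define g where "g i j k = ennreal (2 powr (real (Suc k) * (p - t i - t j))) * G (Suc k) i j f" for i j k
  define C1 where "C1 i = ennreal (4 powr p * Cd * K i / \<kappa> i) * (\<Sum>j\<in>I. \<integral>\<^sup>+x. epow (ennreal \<bar>f x\<bar>) p \<partial>H j)" for i
  define C2 where "C2 i = ennreal ((2 * card I) powr p * (1 + 8 powr p * Cd ^ 4 * K i / (\<kappa> i)\<^sup>2))" for i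
  have "(\<Sum>k. ennreal (2 powr (real (Suc k) * (\<theta> - p))) *
      (\<integral>\<^sup>+x. epow (Eosc (m (Suc k)) f (cball x ((1/2)^(Suc k)))) p \<partial>m (Suc k))) \<le> (\<Sum>k. \<Sum>i\<in>I. \<tau> i k)"
    unfolding \<tau>_def sum_distrib_left[symmetric]
    by (intro suminf_le mult_left_mono nn_integral_m_le) auto
  also have "\<dots> = (\<Sum>i\<in>I. \<Sum>k. \<tau> i k)"
    by (rule suminf_sum) auto
  also have "\<dots> \<le> (\<Sum>i\<in>I. C1 i + C2 i * ((\<Sum>k. e i k) + (\<Sum>j\<in>I - {i}. \<Sum>k. g i j k)))"
  proof (rule sum_mono)
    fix i assume i: "i \<in> I"
    have 0: "\<tau> i 0 \<le> C1 i"
      using level_1_le[OF i f] by (simp add: \<tau>_def C1_def)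
    have "(\<Sum>n. \<tau> i (Suc n)) \<le> (\<Sum>n. C2 i * (e i (Suc n) + (\<Sum>j\<in>I - {i}. g i j n)))"
      unfolding \<tau>_def e_def g_def C2_def using level_ge_2_le[OF i f]
      by (intro suminf_le) auto
    also have "\<dots> = C2 i * ((\<Sum>n. e i (Suc n)) + (\<Sum>j\<in>I - {i}. \<Sum>k. g i j k))"
      by (simp add: suminf_add[symmetric] suminf_sum)
    \<comment> \<open>The Besov series lacks its first term and is enlarged to the full one. The
      gluing series is already complete, its index being one lower.\<close>
    also have "(\<Sum>n. e i (Suc n)) \<le> (\<Sum>n. e i n)"
      unfolding sums_unique[OF sums_Suc[OF summable_sums[OF summableI, of "\<lambda>n. e i (Suc n)"]], symmetric]
      by simp
    finally have 1: "(\<Sum>n. \<tau> i (Suc n)) \<le> C2 i * ((\<Sum>k. e i k) + (\<Sum>j\<in>I - {i}. \<Sum>k. g i j k))"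
      by (simp add: add_right_mono mult_left_mono)
    have "(\<Sum>k. \<tau> i k) = (\<Sum>n. \<tau> i (Suc n)) + \<tau> i 0"
      using sums_unique[OF sums_Suc[OF summable_sums[OF summableI, of "\<lambda>n. \<tau> i (Suc n)"]]] by simp
    then show "(\<Sum>k. \<tau> i k) \<le> C1 i + C2 i * ((\<Sum>k. e i k) + (\<Sum>j\<in>I - {i}. \<Sum>k. g i j k))"
      using add_mono[OF 0 1] by (simp add: add.commute)
  qed
  finally show ?thesis
    unfolding e_def g_def C1_def C2_def .
qed

end

subsection \<open>Codimensional Hausdorff measures\<close>

lemma Hcal_empty [simp]: "Hcal M vt {} = 0"
proof -
  have "Hdelta M vt \<delta> {} \<le> 0" for \<delta>
    unfolding Hdelta_def by (rule INF_lower2[of "{}"]) (auto simp: nn_integral_empty)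
  then show ?thesis
    unfolding Hcal_def by (auto intro!: antisym SUP_least)
qed

lemma sets_Hrestr: "sets (Hrestr M vt S) = sets borel"
  unfolding Hrestr_def by (subst sets_measure_of) (auto simp: sets.sigma_sets_eq[of borel, simplified])

text \<open>A set function that fails to be a measure is turned into the zero measure by
  \<open>measure_of\<close>; all estimates below hold trivially for the latter, so that the countable
  additivity of \<open>Hcal\<close> on Borel sets is never needed.\<close>

lemma emeasure_Hrestr_cases:
  obtains "\<And>E. E \<in> sets borel \<Longrightarrow> emeasure (Hrestr M vt S) E = Hcal M vt (E \<inter> S)"
  | "\<And>E. emeasure (Hrestr M vt S) E = 0"
  unfolding Hrestr_def emeasure_measure_of_conv
  by (cases "measure_space UNIV (sets borel) (\<lambda>E. Hcal M vt (E \<inter> S))")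
    (auto simp: sets.sigma_sets_eq[of borel, simplified])

text \<open>A ball of radius below \<delta> has mass at most \<open>\<delta> powr vt\<close> times
  its contribution to the Hausdorff sum. Covers with bounded sums therefore have total mass tending
  to 0 with \<delta>.\<close>

lemma Hcal_finite_imp_null:
  fixes M :: "'a::metric_space measure"
  assumes M: "sets M = sets borel" and vt: "0 < vt" and E: "E \<in> sets borel" and fin: "Hcal M vt E < \<infinity>"
  shows "E \<in> null_sets M"
proof -
  obtain c where c: "Hcal M vt E = ennreal c" "0 \<le> c"
    using fin by (cases "Hcal M vt E") auto
  \<comment> \<open>The slack in \<open>c + 1\<close> guarantees a cover whose sum lies strictly
    below it.\<close>
  have *: "emeasure M E \<le> ennreal (\<delta> powr vt * (c + 1))" if \<delta>: "0 < \<delta>" for \<delta>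
  proof -
    have "Hdelta M vt \<delta> E \<le> ennreal c"
      unfolding c(1)[symmetric] Hcal_def using \<delta> by (intro SUP_upper) auto
    also have "\<dots> < ennreal (c + 1)"
      using c(2) by (intro ennreal_lessI) auto
    finally obtain F where F: "countable F" "\<And>b. b \<in> F \<Longrightarrow> 0 < snd b \<and> snd b < \<delta>"
        "E \<subseteq> (\<Union>b\<in>F. cball (fst b) (snd b))"
      and le: "(\<integral>\<^sup>+b. emeasure M (cball (fst b) (snd b)) * ennreal (snd b powr (-vt)) \<partial>count_space F) < ennreal (c + 1)"
      unfolding Hdelta_def INF_less_iff by (auto simp: case_prod_beta)
    have "emeasure M E = (\<integral>\<^sup>+x. indicator E x \<partial>M)"
      using E M by simp
    \<comment> \<open>Countable subadditivity along the cover is obtained by interchanging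
      integration with the counting measure on \<open>F\<close>.\<close>
    also have "\<dots> \<le> (\<integral>\<^sup>+x. \<integral>\<^sup>+b. indicator (cball (fst b) (snd b)) x \<partial>count_space F \<partial>M)"
    proof (intro nn_integral_mono)
      fix x
      show "indicator E x \<le> (\<integral>\<^sup>+b. indicator (cball (fst b) (snd b)) x \<partial>count_space F)"
      proof (cases "x \<in> E")
        case True
        then obtain b where b: "b \<in> F" "x \<in> cball (fst b) (snd b)"
          using F(3) by blast
        have "1 = (\<integral>\<^sup>+b'. indicator {b} b' \<partial>count_space F)"
          using b(1) by simp
        also have "\<dots> \<le> (\<integral>\<^sup>+b. indicator (cball (fst b) (snd b)) x \<partial>count_space F)"
          using b(2) by (intro nn_integral_mono) (auto split: split_indicator)
        finally show ?thesis
          using True by simp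
      qed simp
    qed
    also have "\<dots> = (\<integral>\<^sup>+b. \<integral>\<^sup>+x. indicator (cball (fst b) (snd b)) x \<partial>M \<partial>count_space F)"
      by (intro nn_integral_count_space_nn_integral F(1) borel_measurable_indicator) (simp add: M)
    also have "\<dots> = (\<integral>\<^sup>+b. emeasure M (cball (fst b) (snd b)) \<partial>count_space F)"
      by (intro nn_integral_cong nn_integral_indicator) (simp add: M)
    also have "\<dots> \<le> (\<integral>\<^sup>+b. ennreal (\<delta> powr vt) * (emeasure M (cball (fst b) (snd b)) * ennreal (snd b powr (-vt))) \<partial>count_space F)"
    proof (intro nn_integral_mono)
      fix b assume "b \<in> space (count_space F)"
      then have b: "0 < snd b" "snd b < \<delta>"
        using F(2) by auto
      have "ennreal 1 \<le> ennreal (\<delta> powr vt * snd b powr (-vt))"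
        using b vt powr_mono2[of vt "snd b" \<delta>] by (intro ennreal_leI) (simp add: powr_minus field_simps)
      then have "emeasure M (cball (fst b) (snd b)) * ennreal 1
          \<le> emeasure M (cball (fst b) (snd b)) * ennreal (\<delta> powr vt * snd b powr (-vt))"
        by (rule mult_left_mono) simp
      then show "emeasure M (cball (fst b) (snd b)) \<le>
          ennreal (\<delta> powr vt) * (emeasure M (cball (fst b) (snd b)) * ennreal (snd b powr (-vt)))"
        by (simp add: ennreal_mult ac_simps)
    qed
    also have "\<dots> = ennreal (\<delta> powr vt) *
        (\<integral>\<^sup>+b. emeasure M (cball (fst b) (snd b)) * ennreal (snd b powr (-vt)) \<partial>count_space F)"
      by (intro nn_integral_cmult) auto
    also have "\<dots> \<le> ennreal (\<delta> powr vt) * ennreal (c + 1)"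
      using le by (intro mult_left_mono) auto
    finally show ?thesis
      using c(2) by (simp add: ennreal_mult)
  qed
  have "emeasure M E \<le> 0 + ennreal e" if e: "0 < e" for e
  proof -
    define \<delta> where "\<delta> = (e / (c + 1)) powr (1 / vt)"
    have "0 < \<delta>" "\<delta> powr vt * (c + 1) = e"
      using e c(2) vt by (auto simp: \<delta>_def powr_powr)
    then show ?thesis
      using *[of \<delta>] by simp
  qed
  then have "emeasure M E \<le> 0"
    by (rule ennreal_le_epsilon)
  then show ?thesis
    using E M by (auto simp: null_sets_def)
qed

context doubling_measure
begin

text \<open>Upper regularity at radius 1 gives finite Hausdorff measure, hence mass zero, near each
  point of \<open>S\<close>. A point outside the closed set \<open>S\<close> has a ball disjoint
  from it, and countably many such balls cover the space.\<close>

lemma ADR_imp_null: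
  assumes S: "ADR M vt S" and vt: "0 < vt"
  shows "S \<in> null_sets M"
proof -
  obtain k2 where cl: "closed S"
    and k2: "\<And>x. x \<in> S \<Longrightarrow> Hcal M vt (cball x 1 \<inter> S) \<le> ennreal k2 * emeasure M (cball x 1) * ennreal (1 powr - vt)"
    using S unfolding ADR_def by fastforce
  have "\<exists>r>0. ball x r \<inter> S \<in> null_sets M" for x
  proof (cases "x \<in> S")
    case True
    have "Hcal M vt (cball x 1 \<inter> S) \<le> ennreal k2 * ennreal (V 1 x)"
      using k2[OF True] by (simp add: emeasure_cball)
    also have "\<dots> < \<infinity>"
      by (simp add: ennreal_mult_less_top)
    finally have "cball x 1 \<inter> S \<in> null_sets M"
      using vt cl by (intro Hcal_finite_imp_null[OF sets_M]) auto
    then have "ball x 1 \<inter> S \<in> null_sets M"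
      by (rule null_sets_subset) (use cl in \<open>auto simp: sets_M\<close>)
    then show ?thesis
      by (intro exI[of _ 1]) auto
  next
    case False
    then obtain r where "0 < r" "ball x r \<subseteq> - S"
      using cl by (meson ComplI open_Compl openE)
    then have "ball x r \<inter> S = {}"
      by auto
    with \<open>0 < r\<close> show ?thesis
      by (intro exI[of _ r]) auto
  qed
  then obtain r where r: "0 < r x" "ball x (r x) \<inter> S \<in> null_sets M" for x
    by metis
  obtain X where X: "countable X" "(\<Union>x\<in>X. ball x (r x)) = UNIV"
    using r(1) by (rule countable_ball_cover)
  have "(\<Union>x\<in>X. ball x (r x) \<inter> S) \<in> null_sets M"
    using X(1) r(2) by (intro null_sets_UN') auto
  also have "(\<Union>x\<in>X. ball x (r x) \<inter> S) = S"
    using X(2) by auto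
  finally show ?thesis .
qed

text \<open>The complement of \<open>S\<close> is null for the restricted measure, so the lower
  bound at points of \<open>S\<close> holds almost everywhere. The upper bound is carried to
  arbitrary centres at the cost of \<open>Cd\<^sup>2\<close>.\<close>

lemma regular_Hrestr:
  assumes S: "ADR M vt S" and vt: "0 < vt"
  shows "\<exists>k K. regular vt k K (Hrestr M vt S)"
proof -
  obtain k1 k2 where cl: "closed S" and k: "0 < k1" "0 < k2"
    and lower: "\<And>x r. x \<in> S \<Longrightarrow> 0 < r \<Longrightarrow> r \<le> 1 \<Longrightarrow>
      ennreal k1 * emeasure M (cball x r) * ennreal (r powr - vt) \<le> Hcal M vt (cball x r \<inter> S)"
    and upper: "\<And>x r. x \<in> S \<Longrightarrow> 0 < r \<Longrightarrow> r \<le> 1 \<Longrightarrow>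
      Hcal M vt (cball x r \<inter> S) \<le> ennreal k2 * emeasure M (cball x r) * ennreal (r powr - vt)"
    using S unfolding ADR_def by auto
  let ?H = "Hrestr M vt S"
  have "regular vt k1 (k2 * Cd\<^sup>2) ?H"
    unfolding regular_def
  proof (intro conjI allI ballI sets_Hrestr)
    show "0 < k1" "0 < k2 * Cd\<^sup>2"
      using k Cd_ge_1 by auto
    show "AE x in ?H. \<forall>r\<in>{0<..1}. ennreal (k1 * V r x * r powr - vt) \<le> emeasure ?H (cball x r)"
    proof (cases rule: emeasure_Hrestr_cases[of M vt S])
      case 1
      have "emeasure ?H (- S) = 0"
        using cl by (subst 1) auto
      then have "AE x in ?H. x \<in> S"
        using cl by (intro AE_I'[of "- S"]) (auto simp: null_sets_def sets_Hrestr)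
      then show ?thesis
      proof eventually_elim
        case (elim x)
        show ?case
          using lower[OF elim] k by (auto simp: 1 emeasure_cball ennreal_mult)
      qed
    next
      case 2
      then show ?thesis
        by (intro AE_I'[of "space ?H"]) (auto simp: null_sets_def)
    qed
    fix x and r :: real assume r: "r \<in> {0<..1/2}"
    show "emeasure ?H (cball x r) \<le> ennreal (k2 * Cd\<^sup>2 * V r x * r powr - vt)"
    proof (cases rule: emeasure_Hrestr_cases[of M vt S])
      case 1
      show ?thesis
      proof (cases "cball x r \<inter> S = {}")
        case True
        then show ?thesis
          by (simp add: 1)
      next
        case False
        then obtain u where u: "u \<in> S" "dist x u \<le> r"
          by auto
        \<comment> \<open>The ball is recentred at a point of \<open>S\<close>. The radius doubles,
          and \<open>r \<le> 1/2\<close> keeps it within the range of the regularity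
          condition.\<close>
        have "emeasure ?H (cball x r) \<le> emeasure ?H (cball u (2 * r))"
        proof (intro emeasure_mono subsetI)
          fix w assume "w \<in> cball x r"
          then show "w \<in> cball u (2 * r)"
            using u(2) dist_triangle3[of u w x] by simp
        qed (simp add: sets_Hrestr)
        also have "\<dots> \<le> ennreal (k2 * V (2 * r) u * (2 * r) powr - vt)"
          using upper[OF u(1), of "2 * r"] r k by (simp add: 1 emeasure_cball ennreal_mult)
        also have "\<dots> \<le> ennreal (k2 * (Cd\<^sup>2 * V r x) * r powr - vt)"
        proof (intro ennreal_leI mult_mono)
          have "V (2 * r) u \<le> Cd * V r u"
            using r by (intro V_double) auto
          also have "\<dots> \<le> Cd * (Cd * V r x)"
            using r u Cd_ge_1 by (intro mult_left_mono V_double_near) auto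
          finally show "V (2 * r) u \<le> Cd\<^sup>2 * V r x"
            by (simp add: power2_eq_square)
          show "(2 * r) powr - vt \<le> r powr - vt"
            using r vt by (intro powr_mono2') auto
        qed (use k in auto)
        finally show ?thesis
          by (simp add: ac_simps)
      qed
    qed simp
  qed
  then show ?thesis
    by blast
qed

end

section \<open>From the standing assumptions to the final estimate\<close>

lemma standing_space_imp_doubling_measure:
  assumes "standing_space M p"
  obtains Cd where "doubling_measure M Cd"
proof -
  have M: "sets M = sets borel"
    and fin: "\<And>x. \<exists>r>0. emeasure M (cball x r) < \<infinity>"
    and pos: "\<And>x r. r > 0 \<Longrightarrow> emeasure M (cball x r) > 0"
    and dbl: "\<And>R. R > 0 \<Longrightarrow> \<exists>C::real. \<forall>r\<in>{0<..R}. \<forall>x. emeasure M (cball x (2*r)) \<le> ennreal C * emeasure M (cball x r)"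
    using assms unfolding standing_space_def by auto
  obtain C :: real where C: "\<forall>r\<in>{0<..1}. \<forall>x. emeasure M (cball x (2*r)) \<le> ennreal C * emeasure M (cball x r)"
    using dbl[of 1] by auto
  have "doubling_measure M (max 1 C)"
  proof
    fix x and r :: real
    obtain r0 where r0: "0 < r0" "emeasure M (cball x r0) < \<infinity>"
      using fin by blast
    \<comment> \<open>Finite mass spreads from one small ball to all radii by repeated doubling,
      each step using the constant for its own range of radii.\<close>
    have fin': "emeasure M (cball x (2 ^ n * r0)) < \<infinity>" for n
    proof (induction n)
      case (Suc n)
      have R: "0 < 2 ^ n * r0"
        using r0 by simp
      obtain C' :: real where C': "\<forall>r\<in>{0<..2 ^ n * r0}. \<forall>x. emeasure M (cball x (2*r)) \<le> ennreal C' * emeasure M (cball x r)"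
        using dbl[OF R] by blast
      have "emeasure M (cball x (2 * (2 ^ n * r0))) \<le> ennreal C' * emeasure M (cball x (2 ^ n * r0))"
        using C' R by simp
      also have "\<dots> < \<infinity>"
        using Suc by (simp add: ennreal_mult_less_top)
      finally show ?case
        by (simp add: mult.assoc)
    qed (use r0 in simp)
    obtain n where "r / r0 < 2 ^ n"
      using real_arch_pow[of 2 "r / r0"] by auto
    then have "r \<le> 2 ^ n * r0"
      using r0 by (simp add: field_simps)
    then have "emeasure M (cball x r) \<le> emeasure M (cball x (2 ^ n * r0))"
      by (intro emeasure_mono subset_cball) (simp_all add: M)
    then show "emeasure M (cball x r) < \<infinity>"
      using fin' by (rule le_less_trans)
    show "emeasure M (cball x (2 * r)) \<le> ennreal (max 1 C) * emeasure M (cball x r)" if "0 < r" "r \<le> 1"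
    proof -
      have "emeasure M (cball x (2 * r)) \<le> ennreal C * emeasure M (cball x r)"
        using C that by simp
      also have "\<dots> \<le> ennreal (max 1 C) * emeasure M (cball x r)"
        by (intro mult_right_mono ennreal_leI) auto
      finally show ?thesis .
    qed
  qed (use M pos in auto)
  then show ?thesis
    by (rule that)
qed

theorem theorem3p12:
  fixes M :: "'a::{complete_space, second_countable_topology} measure"
    and p \<theta>low \<theta> :: real and N :: nat and th \<sigma>i :: "nat \<Rightarrow> real" and S :: "nat \<Rightarrow> 'a set"
    and \<sigma> :: real
  assumes space: "standing_space M p"
    and th_low: "0 \<le> \<theta>low" "\<theta>low < min p (Qlow M)"
    and th_range: "\<theta>low \<le> \<theta>" "\<theta> < p"
    and N2: "2 \<le> N"
    and th_pos: "0 < th 1"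
    and th_mono: "\<forall>i\<in>{1..<N}. th i < th (Suc i)"
    and th_N: "th N = \<theta>low"
    and ADR: "\<forall>i\<in>{1..N}. ADR M (th i) (S i)"
    and sig_i: "\<forall>i\<in>{1..N}. 0 < \<sigma>i i \<and> \<sigma>i i < 1 \<and> porous (S i) (\<sigma>i i)"
    and sig: "0 < \<sigma>" "\<sigma> \<le> (\<Prod>i\<in>{1..N}. 2 * \<sigma>i i / 3)"
  shows "\<exists>C>0. \<forall>f::'a \<Rightarrow> real. f \<in> borel_measurable borel \<longrightarrow>
            (\<forall>i\<in>{1..N}. (\<integral>\<^sup>+x. epow (ennreal \<bar>f x\<bar>) p \<partial>Hrestr M (th i) (S i)) < \<infinity>) \<longrightarrow>
          BN M p \<theta> (mk M \<theta> N th S) (\<Union>i\<in>{1..N}. S i) \<sigma> f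
            \<le> ennreal C * ((\<Sum>i\<in>{1..N}. Besov M (th i) (1 - th i / p) p (S i) f) + GL M p N th S f)"
proof -
  have p: "1 < p"
    using space by (simp add: standing_space_def)
  have th_gt_0: "0 < th i" if "i \<in> {1..N}" for i
  proof -
    have "1 \<le> i \<Longrightarrow> i \<le> N \<Longrightarrow> 0 < th i" for i
    proof (induction i rule: dec_induct)
      case (step i)
      then show ?case
        using bspec[OF th_mono, of i] by simp
    qed (rule th_pos)
    then show ?thesis
      using that by simp
  qed
  obtain Cd where "doubling_measure M Cd"
    using space by (rule standing_space_imp_doubling_measure)
  then interpret doubling_measure M Cd .
  define H where "H i = Hrestr M (th i) (S i)" for i
  have "\<forall>i\<in>{1..N}. \<exists>k K. regular (th i) k K (H i)"
    using regular_Hrestr ADR th_gt_0 by (simp add: H_def)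
  then obtain \<kappa> K where reg: "\<And>i. i \<in> {1..N} \<Longrightarrow> regular (th i) (\<kappa> i) (K i) (H i)"
    by metis
  define m where "m = mk M \<theta> N th S"
  interpret regular_family M Cd "{1..N}" H th \<kappa> K p \<theta> m
    by unfold_locales (use reg th_gt_0 p th_range in \<open>auto simp: m_def mk_def H_def\<close>)
  have null: "(\<Union>i\<in>{1..N}. S i) \<in> null_sets M"
    using ADR th_gt_0 by (intro null_sets_UN' ADR_imp_null) auto
  define A B where "A i = 4 powr p * Cd * K i / \<kappa> i"
    and "B i = (2 * N) powr p * (1 + 8 powr p * Cd ^ 4 * K i / (\<kappa> i)\<^sup>2)" for i
  have AB: "0 \<le> A i" "0 \<le> B i" if "i \<in> {1..N}" for i
    using regularD(2,3)[OF reg[OF that]] Cd_ge_1 by (auto simp: A_def B_def)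
  \<comment> \<open>Every \<open>L_p\<close> integral, Besov series and gluing sum is at most the
    \<open>p\<close>-th power of the right-hand side. For each \<open>i\<close> there are
    \<open>N\<close> such terms with factor \<open>A i\<close> and two with factor
    \<open>B i\<close>, and \<open>2 \<le> 1 + N\<close>.\<close>
  define D where "D = (\<Sum>i\<in>{1..N}. A i * N + B i * (1 + N))"
  have D: "0 \<le> D"
    unfolding D_def using AB by (intro sum_nonneg) auto
  define C where "C = N powr (1 / p) + D powr (1 / p)"
  have "BN M p \<theta> m (\<Union>i\<in>{1..N}. S i) \<sigma> f
      \<le> ennreal C * ((\<Sum>i\<in>{1..N}. Besov M (th i) (1 - th i / p) p (S i) f) + GL M p N th S f)"
    (is "_ \<le> ennreal C * ?R") if f [measurable]: "f \<in> borel_measurable borel" for f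
  proof -
    \<comment> \<open>Estimates are made between \<open>p\<close>-th powers: \<open>unroot\<close>
      passes from a summand of the right-hand side to its \<open>p\<close>-th power, and
      \<open>root\<close> returns to the norms.\<close>
    have root: "epow X (1 / p) \<le> ennreal (c powr (1 / p)) * ?R" if "X \<le> ennreal c * epow ?R p" "0 \<le> c" for X c
    proof -
      have "epow X (1 / p) \<le> epow (ennreal c * epow ?R p) (1 / p)"
        using that p by (intro epow_mono) auto
      also have "\<dots> = ennreal (c powr (1 / p)) * ?R"
        using that p by (simp add: epow_mult epow_ennreal epow_epow)
      finally show ?thesis .
    qed
    have unroot: "X \<le> epow ?R p" if "epow X (1 / p) \<le> ?R" for X
      using epow_mono[OF that, of p] p by (simp add: epow_epow)
    define L where "L i = (\<integral>\<^sup>+x. epow (ennreal \<bar>f x\<bar>) p \<partial>H i)" for i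
    define e where "e i = (\<Sum>k. ennreal (2 powr (real (Suc k) * (p - th i))) *
        (\<integral>\<^sup>+x. epow (Eosc (H i) f (cball x ((1/2)^(Suc k)))) p \<partial>H i))" for i
    define g where "g i j = (\<Sum>k. ennreal (2 powr (real (Suc k) * (p - th i - th j))) * G (Suc k) i j f)" for i j
    have Besov: "Besov M (th i) (1 - th i / p) p (S i) f = epow (L i) (1 / p) + epow (e i) (1 / p)" for i
    proof -
      have "real (Suc k) * (1 - th i / p) * p = real (Suc k) * (p - th i)" for k
        using p by (simp add: field_simps)
      then show ?thesis
        by (simp only: Besov_def Lpnorm_def L_def e_def H_def)
    qed
    have GL: "GL M p N th S f = epow (\<Sum>(i,j)\<in>{(i,j). i \<in> {1..N} \<and> j \<in> {1..N} \<and> i \<noteq> j}. g i j) (1 / p)"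
      by (simp only: GL_def g_def G_def H_def)
    have Besov_le: "Besov M (th i) (1 - th i / p) p (S i) f \<le> ?R" if "i \<in> {1..N}" for i
    proof -
      have "Besov M (th i) (1 - th i / p) p (S i) f \<le> (\<Sum>i\<in>{1..N}. Besov M (th i) (1 - th i / p) p (S i) f)"
        using that by (intro member_le_sum) auto
      then show ?thesis
        by (rule order_trans) simp
    qed
    have L_le: "L i \<le> epow ?R p" and e_le: "e i \<le> epow ?R p" if "i \<in> {1..N}" for i
      by (rule unroot, rule order_trans[OF _ Besov_le[OF that]], simp add: Besov)+
    have g_le: "(\<Sum>j\<in>{1..N} - {i}. g i j) \<le> epow ?R p" if "i \<in> {1..N}" for i
    proof -
      \<comment> \<open>For fixed \<open>i\<close> this is part of the nonnegative sum over ordered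
        pairs in the gluing functional.\<close>
      have "(\<Sum>j\<in>{1..N} - {i}. g i j) = (\<Sum>(i,j)\<in>Pair i ` ({1..N} - {i}). g i j)"
        by (subst sum.reindex) (auto simp: inj_on_def)
      also have "\<dots> \<le> (\<Sum>(i,j)\<in>{(i,j). i \<in> {1..N} \<and> j \<in> {1..N} \<and> i \<noteq> j}. g i j)"
      proof (rule sum_mono2)
        show "finite {(i,j). i \<in> {1..N} \<and> j \<in> {1..N} \<and> i \<noteq> j}"
          by (rule finite_subset[of _ "{1..N} \<times> {1..N}"]) auto
      qed (use that in auto)
      also have "\<dots> \<le> epow ?R p"
        by (rule unroot, fold GL) simp
      finally show ?thesis .
    qed
    have "Lpnorm (m 0) p f \<le> ennreal (real N powr (1 / p)) * ?R"
      unfolding Lpnorm_def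
    proof (rule root)
      \<comment> \<open>At level 0 all weights are 1, so the integral against \<open>m 0\<close> is
        bounded by the plain sum of the \<open>N\<close> integrals \<open>L i\<close>.\<close>
      have a_0: "a 0 i = 1" for i
        by (simp add: a_def)
      have "(\<integral>\<^sup>+x. epow (ennreal \<bar>f x\<bar>) p \<partial>m 0) \<le> (\<Sum>i\<in>{1..N}. ennreal (a 0 i) * L i)"
        unfolding L_def by (rule nn_integral_m_le)
      also have "\<dots> \<le> (\<Sum>i\<in>{1..N}. epow ?R p)"
        using a_0 by (intro sum_mono) (simp only: ennreal_1 mult_1 L_le)
      finally show "(\<integral>\<^sup>+x. epow (ennreal \<bar>f x\<bar>) p \<partial>m 0) \<le> ennreal (real N) * epow ?R p"
        by (simp add: ennreal_of_nat_eq_real_of_nat)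
    qed simp
    moreover have "(\<integral>\<^sup>+x. epow (sharp m (\<Union>i\<in>{1..N}. S i) f x) p * indicator (\<Union>i\<in>{1..N}. S i) x \<partial>M) = 0"
    proof -
      have "AE x in M. x \<notin> (\<Union>i\<in>{1..N}. S i)"
        using null by (rule AE_not_in)
      then have "(\<integral>\<^sup>+x. epow (sharp m (\<Union>i\<in>{1..N}. S i) f x) p * indicator (\<Union>i\<in>{1..N}. S i) x \<partial>M) = (\<integral>\<^sup>+x. 0 \<partial>M)"
        by (intro nn_integral_cong_AE) (auto simp: indicator_def)
      then show ?thesis
        by simp
    qed
    moreover have "epow (\<Sum>k. ennreal (2 powr (real (Suc k) * (\<theta> - p))) *
        (\<integral>\<^sup>+x. epow (Eosc (m (Suc k)) f (cball x ((1/2)^(Suc k)))) p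
          * indicator (porous_part (\<Union>i\<in>{1..N}. S i) ((1/2)^(Suc k)) \<sigma>) x \<partial>m (Suc k))) (1/p)
      \<le> ennreal (D powr (1 / p)) * ?R"
    proof (rule root[OF _ D])
      have "(\<Sum>k. ennreal (2 powr (real (Suc k) * (\<theta> - p))) *
          (\<integral>\<^sup>+x. epow (Eosc (m (Suc k)) f (cball x ((1/2)^(Suc k)))) p
            * indicator (porous_part (\<Union>i\<in>{1..N}. S i) ((1/2)^(Suc k)) \<sigma>) x \<partial>m (Suc k)))
        \<le> (\<Sum>k. ennreal (2 powr (real (Suc k) * (\<theta> - p))) *
          (\<integral>\<^sup>+x. epow (Eosc (m (Suc k)) f (cball x ((1/2)^(Suc k)))) p \<partial>m (Suc k)))"
        by (intro suminf_le mult_left_mono nn_integral_mono) (auto split: split_indicator)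
      also have "\<dots> \<le> (\<Sum>i\<in>{1..N}. ennreal (A i) * (\<Sum>j\<in>{1..N}. L j)
          + ennreal (B i) * (e i + (\<Sum>j\<in>{1..N} - {i}. g i j)))"
        using level_sum_le[OF f] unfolding A_def B_def L_def e_def g_def by simp
      also have "\<dots> \<le> (\<Sum>i\<in>{1..N}. ennreal (A i * N + B i * (1 + N)) * epow ?R p)"
      proof (rule sum_mono)
        fix i assume i: "i \<in> {1..N}"
        have "(\<Sum>j\<in>{1..N}. L j) \<le> (\<Sum>j\<in>{1..N}. epow ?R p)"
          by (intro sum_mono L_le)
        then have 1: "(\<Sum>j\<in>{1..N}. L j) \<le> ennreal N * epow ?R p"
          by (simp add: ennreal_of_nat_eq_real_of_nat)
        have "e i + (\<Sum>j\<in>{1..N} - {i}. g i j) \<le> epow ?R p + epow ?R p"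
          using i by (intro add_mono e_le g_le)
        also have "\<dots> = ennreal 2 * epow ?R p"
          by (simp add: mult_2)
        also have "\<dots> \<le> ennreal (1 + N) * epow ?R p"
          using N2 by (intro mult_right_mono ennreal_leI) auto
        finally have 2: "e i + (\<Sum>j\<in>{1..N} - {i}. g i j) \<le> ennreal (1 + N) * epow ?R p" .
        have "ennreal (A i) * (\<Sum>j\<in>{1..N}. L j) + ennreal (B i) * (e i + (\<Sum>j\<in>{1..N} - {i}. g i j))
            \<le> ennreal (A i) * (ennreal N * epow ?R p) + ennreal (B i) * (ennreal (1 + N) * epow ?R p)"
          using 1 2 by (intro add_mono mult_left_mono) auto
        also have "\<dots> = ennreal (A i * N + B i * (1 + N)) * epow ?R p"
          using AB[OF i] by (simp only: mult.assoc[symmetric] distrib_right[symmetric] ennreal_mult[symmetric] ennreal_plus[symmetric]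
            of_nat_0_le_iff mult_nonneg_nonneg add_nonneg_nonneg zero_le_one)
        finally show "ennreal (A i) * (\<Sum>j\<in>{1..N}. L j) + ennreal (B i) * (e i + (\<Sum>j\<in>{1..N} - {i}. g i j))
            \<le> ennreal (A i * N + B i * (1 + N)) * epow ?R p" .
      qed
      also have "\<dots> = ennreal D * epow ?R p"
        unfolding D_def sum_distrib_right[symmetric] using AB
        by (subst sum_ennreal) auto
      finally show "(\<Sum>k. ennreal (2 powr (real (Suc k) * (\<theta> - p))) *
          (\<integral>\<^sup>+x. epow (Eosc (m (Suc k)) f (cball x ((1/2)^(Suc k)))) p
            * indicator (porous_part (\<Union>i\<in>{1..N}. S i) ((1/2)^(Suc k)) \<sigma>) x \<partial>m (Suc k)))
        \<le> ennreal D * epow ?R p" .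
    qed
    ultimately have "BN M p \<theta> m (\<Union>i\<in>{1..N}. S i) \<sigma> f
        \<le> ennreal (real N powr (1 / p)) * ?R + 0 + ennreal (D powr (1 / p)) * ?R"
      unfolding BN_def by (intro add_mono) simp_all
    then show ?thesis
      by (simp add: C_def distrib_right)
  qed
  moreover have "0 < C"
    using N2 by (simp add: C_def add_pos_nonneg)
  ultimately show ?thesis
    unfolding m_def by (intro exI[of _ C]) simp
qed

end
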